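(* Let $n,p$ be positive integers with $2p\le n$ and let $f:\mathbb{R}^{n\times p}\to\mathbb{R}$ be twice continuously differentiable. Let $X^0\in\mathbb{R}^{n\times p}$ be a qualified initial guess with constant $\underline{\sigma}\in(0,1)$, let the parameters $c_1,\beta,c_2,\bar\eta,(\eta^k)_{k\ge0}$ satisfy the parameter assumption, and let $\{X^k\}$ be the sequence generated from $X^0$ by the PLAM iteration. Suppose in addition that, for a given $\delta>0$, $\beta>(MN+\delta)/\underline{\sigma}$. Then for any integer $K>1$, $$\min_{k=0,\dots,K-1}\max\left\{\|I_p-{X^k}^\top X^k\|_F,\ \|\nabla_X\mathcal{L}_\beta(X^k,\Lambda^k)\|_F\right\}<\max\left\{\frac{M}{\delta},1\right\}\sqrt{\frac{f(X^0)-\underline{f}+MNR+\beta R^2/4}{c_3K}} .$$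
   Context: Notation: $\Psi(A)=\frac12(A+A^\top)$ for square $A$; $\langle A,B\rangle=\mathrm{tr}(A^\top B)$; $\|\cdot\|_F$ Frobenius norm; $\|\cdot\|_2$ spectral (operator) norm; $\sigma_{\min}$ smallest singular value. $\nabla^2 f(X)$ is viewed as a linear operator on $\mathbb{R}^{n\times p}$ with the Frobenius inner product. The augmented Lagrangian is $\mathcal{L}_\beta(X,\Lambda)=f(X)-\frac12\langle\Lambda,X^\top X-I_p\rangle+\frac{\beta}{4}\|X^\top X-I_p\|_F^2$, so $\nabla_X\mathcal{L}_\beta(X,\Lambda)=\nabla f(X)-X\Lambda+\beta X(X^\top X-I_p)$. PLAM iteration: for $k=0,1,2,\dots$, $\Lambda^k=\Psi(\nabla f(X^k)^\top X^k)$ and $X^{k+1}=X^k-\frac{1}{\eta^k}\nabla_X\mathcal{L}_\beta(X^k,\Lambda^k)$. Qualified initial guess: $X^0$ is a qualified initial guess with constant $\underline{\sigma}\in(0,1)$ if $\sigma_{\min}(X^0)\ge\underline{\sigma}$ and $0<\|{X^0}^\top X^0-I_p\|_F\le 1-\underline{\sigma}^2$. Constants: $R=\|{X^0}^\top X^0-I_p\|_F$; $\mathcal{C}=\{X\in\mathbb{R}^{n\times p}:\|X^\top X-I_p\|_F\le R\}$; $\underline{f}=\min_{X\in\mathcal{C}}f(X)$; $M=\max_{X\in\mathcal{C}}\|X\|_2$; $N=\max_{X\in\mathcal{C}}\|\nabla f(X)\|_F$; $L=\max_{X\in\mathcal{C}}\|\nabla^2 f(X)\|_2$. Merit function: $h(X)=f(X)-\frac12\langle\Psi(\nabla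 f(X)^\top X),X^\top X-I_p\rangle+\frac{\beta}{4}\|X^\top X-I_p\|_F^2$. $L_h>0$ is a constant (depending on $\beta$) such that $\|\nabla h(X)-\nabla h(Y)\|_F\le L_h\|X-Y\|_F$ for all $X,Y\in\mathcal{C}$. $c_3=\frac{c_1}{\bar\eta}-\frac{L_h}{2\bar\eta^2}>0$. Parameter assumption: $c_1\in(0,\frac12)$; $$\beta>\max\left\{\frac{MN}{\underline{\sigma}^2}+\sqrt{\frac{M^2N^2}{\underline{\sigma}^4}+\frac{(N+LM)^2}{4\underline{\sigma}^2(1-2c_1)}},\ \frac{MN}{\underline{\sigma}},\ \frac{4MN}{\underline{\sigma}^2}\right\};$$ with $N_L=(1+M^2)N+\beta RM$, $c_2\in\left(0,\frac{R^2(\beta\underline{\sigma}^2-4MN)}{2N_L^2}\right]$; and $\eta^k\in[\underline{\eta},\bar\eta]$ for all $k$, where $$\underline{\eta}=\max\left\{\frac{L_h}{2c_1},\ \frac{2N_LM+N_L\sqrt{4M^2+2R}}{R},\ \frac{R+2M^2}{c_2}\right\},\qquad \bar\eta\ge\underline{\eta}.$$ *)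

theory Defs
  imports "HOL-Analysis.Analysis"
begin

text \<open>
  An \<open>n \<times> p\<close> real matrix has type \<open>real^'p^'n\<close> (rows outermost). On this type the library's
  \<open>A \<bullet> B\<close> is \<open>tr (A\<^sup>T B)\<close> and \<open>norm A\<close> is the Frobenius norm. The spectral norm of \<open>A\<close> is
  \<open>onorm ((*v) A)\<close>.
\<close>

definition sym_part :: "real^'p^'p \<Rightarrow> real^'p^'p" where
  "sym_part A = (1/2) *\<^sub>R (A + transpose A)"

text \<open>Singular values as square roots of the eigenvalues of \<open>A\<^sup>T A\<close>. For \<open>p \<le> n\<close>, the
  case of interest, these are exactly the \<open>p\<close> singular values of an \<open>n \<times> p\<close> matrix (for \<open>p > n\<close> the
  set would also contain superfluous zeros).\<close>

definition singular_values :: "real^'p^'n \<Rightarrow> real set" where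
  "singular_values A =
     {s. s \<ge> 0 \<and> (\<exists>v. v \<noteq> 0 \<and> (transpose A ** A) *v v = s\<^sup>2 *\<^sub>R v)}"

definition sigma_min :: "real^'p^'n \<Rightarrow> real" where
  "sigma_min A = Min (singular_values A)"

definition grad :: "('a::euclidean_space \<Rightarrow> real) \<Rightarrow> 'a \<Rightarrow> 'a" where
  "grad f x = (THE D. GDERIV f x :> D)"

definition hess :: "('a::euclidean_space \<Rightarrow> real) \<Rightarrow> 'a \<Rightarrow> 'a \<Rightarrow> 'a" where
  "hess f x = frechet_derivative (grad f) (at x)"

text \<open>Continuity of the Hessian is with respect to the operator norm, which is the norm of the
  type of bounded linear maps.\<close>

definition twice_continuously_differentiable ::
    "('a::euclidean_space \<Rightarrow> real) \<Rightarrow> bool" where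
  "twice_continuously_differentiable f \<longleftrightarrow>
     f differentiable_on UNIV \<and> grad f differentiable_on UNIV \<and>
     continuous_on UNIV (\<lambda>x. Blinfun (hess f x))"

definition orth_defect :: "real^'p^'n \<Rightarrow> real^'p^'p" where
  "orth_defect X = transpose X ** X - mat 1"

definition aug_lagrangian ::
    "(real^'p^'n \<Rightarrow> real) \<Rightarrow> real \<Rightarrow> real^'p^'n \<Rightarrow> real^'p^'p \<Rightarrow> real" where
  "aug_lagrangian f \<beta> X \<Lambda> =
     f X - 1/2 * (\<Lambda> \<bullet> orth_defect X) + \<beta>/4 * (norm (orth_defect X))\<^sup>2"

text \<open>The gradient in the first matrix argument. For differentiable \<open>f\<close> and symmetric \<open>\<Lambda>\<close> it equals
  \<open>grad f X - X ** \<Lambda> + \<beta> *\<^sub>R (X ** (transpose X ** X - mat 1))\<close>; the multipliers of the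
  iteration below are symmetric.\<close>

definition grad_aug_lagrangian ::
    "(real^'p^'n \<Rightarrow> real) \<Rightarrow> real \<Rightarrow> real^'p^'n \<Rightarrow> real^'p^'p \<Rightarrow> real^'p^'n" where
  "grad_aug_lagrangian f \<beta> X \<Lambda> = grad (\<lambda>Y. aug_lagrangian f \<beta> Y \<Lambda>) X"

definition multiplier :: "(real^'p^'n \<Rightarrow> real) \<Rightarrow> real^'p^'n \<Rightarrow> real^'p^'p" where
  "multiplier f X = sym_part (transpose (grad f X) ** X)"

definition merit :: "(real^'p^'n \<Rightarrow> real) \<Rightarrow> real \<Rightarrow> real^'p^'n \<Rightarrow> real" where
  "merit f \<beta> X =
     f X - 1/2 * (multiplier f X \<bullet> orth_defect X) + \<beta>/4 * (norm (orth_defect X))\<^sup>2"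

definition qualified_guess :: "real \<Rightarrow> real^'p^'n \<Rightarrow> bool" where
  "qualified_guess \<sigma> X \<longleftrightarrow>
     \<sigma> \<in> {0<..<1} \<and> sigma_min X \<ge> \<sigma> \<and>
     0 < norm (orth_defect X) \<and> norm (orth_defect X) \<le> 1 - \<sigma>\<^sup>2"

text \<open>This set is compact, and it is nonempty for \<open>R \<ge> 0\<close> and \<open>p \<le> n\<close>, so suprema and infima
  over it of continuous real functions are maxima and minima.\<close>

definition feasible_tube :: "real \<Rightarrow> (real^'p^'n) set" where
  "feasible_tube R = {X. norm (orth_defect X) \<le> R}"

definition plam_sequence ::
    "(real^'p^'n \<Rightarrow> real) \<Rightarrow> real \<Rightarrow> (nat \<Rightarrow> real) \<Rightarrow> real^'p^'n \<Rightarrow>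
     (nat \<Rightarrow> real^'p^'n) \<Rightarrow> (nat \<Rightarrow> real^'p^'p) \<Rightarrow> bool" where
  "plam_sequence f \<beta> \<eta> X0 X \<Lambda> \<longleftrightarrow>
     X 0 = X0 \<and>
     (\<forall>k. \<Lambda> k = multiplier f (X k)) \<and>
     (\<forall>k. X (Suc k) = X k - (1 / \<eta> k) *\<^sub>R grad_aug_lagrangian f \<beta> (X k) (\<Lambda> k))"

end

theory Submission
  imports Defs
begin

text \<open>
  Write \<open>E = X\<^sup>T X - I\<close>, \<open>D\<close> for the search direction and \<open>t = 1/\<eta>\<close>. Since \<open>D\<close> is aligned with the
  gradient of the penalty, \<open>norm E\<close> does not increase while it is larger than \<open>R/2\<close>, so the whole
  segment from \<open>X\<close> to \<open>X - t D\<close> stays in the tube \<open>norm E \<le> R\<close>, and the Lipschitz bound for the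
  gradient of the merit function \<open>h\<close> can be used along it.

  The resulting decrease of \<open>h\<close> is only \<open>(c\<^sub>1 t - L\<^sub>h t\<^sup>2/2) (norm D)\<^sup>2\<close>, which can be smaller than
  \<open>c\<^sub>3 (norm D)\<^sup>2\<close>, because \<open>t\<close> is allowed to exceed the maximizer \<open>c\<^sub>1/L\<^sub>h\<close> of this quadratic.
  The decrease falls short only when \<open>\<beta> norm E\<close> is comparable to \<open>norm D\<close>, in which case the penalty
  drops by a definite amount. Hence the potential \<open>3 h + \<beta>/4 (norm E)\<^sup>2\<close> decreases by more than
  \<open>4 c\<^sub>3 (norm D)\<^sup>2\<close> in each step with \<open>D \<noteq> 0\<close>, while its total drop is still at most four times
  the numerator in the bound.
\<close>

subsection \<open>Frobenius norms and the orthogonality defect\<close>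

lemma inner_matrix: "A \<bullet> B = (\<Sum>i\<in>UNIV. \<Sum>j\<in>UNIV. A$i$j * B$i$j)" for A B :: "real^'m^'n"
  by (simp add: inner_vec_def)

lemma inner_transpose: "transpose A \<bullet> transpose B = A \<bullet> B" for A B :: "real^'m^'n"
  unfolding inner_matrix transpose_def by (simp, rule sum.swap)

lemma norm_transpose: "norm (transpose A) = norm A" for A :: "real^'m^'n"
  by (simp add: norm_eq_sqrt_inner inner_transpose)

lemma inner_matrix_mult_left: "(A ** B) \<bullet> C = B \<bullet> (transpose A ** C)"
  for A :: "real^'m^'n" and B :: "real^'p^'m"
proof -
  have "(A ** B) \<bullet> C = (\<Sum>i\<in>UNIV. \<Sum>j\<in>UNIV. \<Sum>k\<in>UNIV. A$i$k * B$k$j * C$i$j)"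
    unfolding inner_matrix matrix_matrix_mult_def by (simp add: sum_distrib_right)
  also have "\<dots> = (\<Sum>k\<in>UNIV. \<Sum>j\<in>UNIV. \<Sum>i\<in>UNIV. A$i$k * B$k$j * C$i$j)"
    apply (subst sum.swap)
    apply (subst (2) sum.swap)
    apply (subst sum.swap)
    by (rule refl)
  also have "\<dots> = B \<bullet> (transpose A ** C)"
    unfolding inner_matrix matrix_matrix_mult_def transpose_def
    by (simp add: sum_distrib_left mult_ac)
  finally show ?thesis .
qed

lemma inner_matrix_mult_right: "(A ** B) \<bullet> C = A \<bullet> (C ** transpose B)"
  for A :: "real^'m^'n" and B :: "real^'p^'m"
proof -
  have "(A ** B) \<bullet> C = (transpose B ** transpose A) \<bullet> transpose C"
    by (metis inner_transpose matrix_transpose_mul)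
  also have "\<dots> = A \<bullet> (C ** transpose B)"
    by (metis inner_matrix_mult_left inner_transpose matrix_transpose_mul transpose_transpose)
  finally show ?thesis .
qed

lemma norm_matrix_columns: "(norm A)\<^sup>2 = (\<Sum>j\<in>UNIV. (norm (column j A))\<^sup>2)"
  for A :: "real^'m^'n"
  unfolding power2_norm_eq_inner inner_matrix
  by (subst sum.swap) (simp add: column_def inner_vec_def)

lemma column_matrix_mult: "column j (A ** B) = A *v column j B"
  for A :: "real^'m^'n" and B :: "real^'p^'m"
  by (simp add: vec_eq_iff column_def matrix_matrix_mult_def matrix_vector_mult_def)

text \<open>The columns of \<open>A ** B\<close> are the images under \<open>A\<close> of the
  columns of \<open>B\<close>, so a bound for \<open>A\<close> as an operator carries over to
  Frobenius norms column by column. This lets the spectral constant \<open>M\<close> appear below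
  where submultiplicativity of the Frobenius norm would be too coarse.\<close>

lemma norm_matrix_mult_le:
  fixes A :: "real^'m^'n" and B :: "real^'p^'m"
  assumes "\<And>v. norm (A *v v) \<le> c * norm v" "c \<ge> 0"
  shows "norm (A ** B) \<le> c * norm B"
proof -
  have "(norm (A ** B))\<^sup>2 \<le> (\<Sum>j\<in>UNIV. (c * norm (column j B))\<^sup>2)"
    unfolding norm_matrix_columns column_matrix_mult
    by (intro sum_mono power_mono assms(1) norm_ge_zero)
  also have "\<dots> = (c * norm B)\<^sup>2"
    by (simp add: power_mult_distrib norm_matrix_columns sum_distrib_left)
  finally show ?thesis by (rule power2_le_imp_le) (simp add: assms(2))
qed

lemma norm_matrix_mult_ge:
  fixes A :: "real^'m^'n" and B :: "real^'p^'m"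
  assumes "\<And>v. norm (A *v v) \<ge> c * norm v" "c \<ge> 0"
  shows "norm (A ** B) \<ge> c * norm B"
proof -
  have "(c * norm B)\<^sup>2 = (\<Sum>j\<in>UNIV. (c * norm (column j B))\<^sup>2)"
    by (simp add: power_mult_distrib norm_matrix_columns sum_distrib_left)
  also have "\<dots> \<le> (norm (A ** B))\<^sup>2"
    unfolding norm_matrix_columns column_matrix_mult
    by (intro sum_mono power_mono assms(1) mult_nonneg_nonneg assms(2) norm_ge_zero)
  finally show ?thesis by (rule power2_le_imp_le) (simp add: assms(2))
qed

lemma norm_matrix_vector_le_norm: "norm (A *v v) \<le> norm A * norm v" for A :: "real^'m^'n"
proof -
  have "(norm (A *v v))\<^sup>2 = (\<Sum>i\<in>UNIV. (A$i \<bullet> v)\<^sup>2)"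
    unfolding power2_norm_eq_inner
    by (simp add: inner_vec_def matrix_vector_mult_def power2_eq_square)
  also have "\<dots> \<le> (\<Sum>i\<in>UNIV. (norm (A$i))\<^sup>2 * (norm v)\<^sup>2)"
    by (intro sum_mono) (metis Cauchy_Schwarz_ineq power2_norm_eq_inner)
  also have "\<dots> = (norm A * norm v)\<^sup>2"
    by (simp add: power_mult_distrib power2_norm_eq_inner inner_vec_def[of A] sum_distrib_right)
  finally show ?thesis by (rule power2_le_imp_le) simp
qed

lemma norm_matrix_mult: "norm (A ** B) \<le> norm A * norm B"
  for A :: "real^'m^'n" and B :: "real^'p^'m"
  by (intro norm_matrix_mult_le norm_matrix_vector_le_norm norm_ge_zero)

text \<open>Duality: the squared norm of \<open>transpose A ** B\<close> is the pairing of
  \<open>B\<close> with \<open>A ** (transpose A ** B)\<close>, to which the bound on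
  \<open>A\<close> applies; one factor then cancels.\<close>

lemma norm_transpose_matrix_mult_le:
  fixes A :: "real^'m^'n" and B :: "real^'p^'n"
  assumes "\<And>v. norm (A *v v) \<le> c * norm v" "c \<ge> 0"
  shows "norm (transpose A ** B) \<le> c * norm B"
proof (cases "norm (transpose A ** B) = 0")
  case False
  let ?C = "transpose A ** B"
  have "norm ?C * norm ?C = B \<bullet> (A ** ?C)"
    by (metis inner_matrix_mult_left power2_norm_eq_inner power2_eq_square transpose_transpose)
  also have "\<dots> \<le> norm B * norm (A ** ?C)"
    by (rule norm_cauchy_schwarz)
  also have "\<dots> \<le> norm B * (c * norm ?C)"
    by (intro mult_left_mono norm_matrix_mult_le assms) auto
  finally show ?thesis using False by (simp add: mult_ac)
next
  case True
  then show ?thesis using assms(2) by auto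
qed

lemma bounded_bilinear_matrix_mult:
  "bounded_bilinear (\<lambda>(A :: real^'m^'n) (B :: real^'p^'m). A ** B)"
proof (intro bounded_bilinear.intro exI[of _ 1] allI)
  show "norm (A ** B) \<le> norm A * norm B * 1" for A :: "real^'m^'n" and B :: "real^'p^'m"
    using norm_matrix_mult by simp
qed (simp_all add: vec_eq_iff matrix_matrix_mult_def sum_distrib_left algebra_simps sum.distrib)

lemma bounded_linear_transpose: "bounded_linear (transpose :: real^'m^'n \<Rightarrow> _)"
  by (rule bounded_linear_intro[where K=1])
     (simp_all add: norm_transpose, simp_all add: transpose_def vec_eq_iff)

lemma sym_part_bounded_linear: "bounded_linear sym_part"
  unfolding sym_part_def[abs_def]
  by (intro bounded_linear_scaleR_right bounded_linear_add bounded_linear_ident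
      bounded_linear_transpose bounded_linear_const_scaleR)

lemma transpose_sym_part: "transpose (sym_part A) = sym_part A"
  by (simp add: sym_part_def transpose_def vec_eq_iff)

lemma norm_sym_part_le: "norm (sym_part A) \<le> norm A"
  using norm_triangle_ineq[of A "transpose A"] by (simp add: sym_part_def norm_transpose)

lemma inner_sym_part:
  assumes "transpose B = B"
  shows "sym_part A \<bullet> B = A \<bullet> B"
  using inner_transpose[of A B] assms by (simp add: sym_part_def inner_add_left)

lemma transpose_orth_defect: "transpose (orth_defect X) = orth_defect X"
proof -
  have "transpose (transpose X ** X) = transpose X ** X"
    by (simp add: matrix_transpose_mul)
  then show ?thesis
    by (simp add: orth_defect_def linear_diff[OF bounded_linear.linear[OF bounded_linear_transpose]]
        transpose_mat)
qed

section \<open>Gradients as representatives of derivatives\<close>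

lemma GDERIV_grad:
  fixes f :: "'a::euclidean_space \<Rightarrow> real"
  assumes "GDERIV f x :> D"
  shows "grad f x = D"
  unfolding grad_def
proof (rule the_equality[where P = "\<lambda>D. GDERIV f x :> D", OF assms])
  fix D' assume "GDERIV f x :> D'"
  then have "(\<lambda>h. h \<bullet> D') = (\<lambda>h. h \<bullet> D)"
    using assms has_derivative_unique unfolding gderiv_def by blast
  then have "h \<bullet> (D' - D) = 0" for h
    by (metis inner_diff_right eq_iff_diff_eq_0)
  then show "D' = D"
    by (metis eq_iff_diff_eq_0 inner_eq_zero_iff)
qed

text \<open>The Riesz representative of a linear functional on a Euclidean space is its adjoint
  applied to 1.\<close>

lemma differentiable_GDERIV_grad:
  fixes f :: "'a::euclidean_space \<Rightarrow> real"
  assumes "f differentiable (at x)"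
  shows "GDERIV f x :> grad f x"
proof -
  obtain f' where f': "(f has_derivative f') (at x)"
    using assms unfolding differentiable_def by blast
  then have "h \<bullet> adjoint f' 1 = f' h" for h
    using adjoint_works[of f' h 1] by (simp add: bounded_linear.linear has_derivative_bounded_linear)
  then have "GDERIV f x :> adjoint f' 1"
    using f' by (simp add: gderiv_def)
  then show ?thesis
    using GDERIV_grad by metis
qed

section \<open>Geometry of the tube\<close>

lemma has_derivative_orth_defect:
  "(orth_defect has_derivative (\<lambda>Y. transpose X ** Y + transpose Y ** X)) (at X)"
  unfolding orth_defect_def[abs_def]
  by (rule derivative_eq_intros bounded_bilinear.FDERIV[OF bounded_bilinear_matrix_mult]
      bounded_linear.has_derivative[OF bounded_linear_transpose] | simp)+

lemma continuous_on_orth_defect: "continuous_on S orth_defect"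
  by (meson continuous_at_imp_continuous_on has_derivative_continuous has_derivative_orth_defect)

lemma compact_feasible_tube: "compact (feasible_tube R :: (real^'p^'n) set)"
proof -
  have "closed (feasible_tube R :: (real^'p^'n) set)"
    unfolding feasible_tube_def
    by (intro closed_Collect_le continuous_intros continuous_on_orth_defect)
  moreover have "bounded (feasible_tube R :: (real^'p^'n) set)"
  proof (rule boundedI)
    fix X :: "real^'p^'n" assume X: "X \<in> feasible_tube R"
    \<comment> \<open>The squared Frobenius norm is the trace of \<open>transpose X ** X\<close>,
      that is, of the defect plus the identity.\<close>
    have "(norm X)\<^sup>2 = (X ** mat 1) \<bullet> X"
      by (simp add: power2_norm_eq_inner)
    also have "\<dots> = mat 1 \<bullet> (orth_defect X + mat 1)"
      unfolding inner_matrix_mult_left by (simp add: orth_defect_def)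
    also have "\<dots> \<le> norm (mat 1 :: real^'p^'p) * (norm (orth_defect X) + norm (mat 1 :: real^'p^'p))"
      by (meson norm_cauchy_schwarz norm_triangle_ineq norm_ge_zero mult_left_mono order_trans)
    also have "\<dots> \<le> norm (mat 1 :: real^'p^'p) * (R + norm (mat 1 :: real^'p^'p))"
      using X by (intro mult_left_mono) (auto simp: feasible_tube_def)
    finally show "norm X \<le> sqrt (norm (mat 1 :: real^'p^'p) * (R + norm (mat 1 :: real^'p^'p)))"
      by (simp add: real_le_rsqrt)
  qed
  ultimately show ?thesis by (simp add: compact_eq_bounded_closed)
qed

text \<open>Since \<open>transpose X ** X\<close> is the identity plus the defect, its quadratic
  form is at least \<open>1 - R\<close> times that of the identity; hence no singular value of
  \<open>X\<close> is below \<open>sqrt (1 - R)\<close>.\<close>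

lemma norm_matrix_vector_ge_of_orth_defect:
  assumes "norm (orth_defect X) \<le> R" "R \<le> 1"
  shows "norm (X *v v) \<ge> sqrt (1 - R) * norm v"
proof -
  have "(norm (X *v v))\<^sup>2 = v \<bullet> (transpose X *v (X *v v))"
    by (metis dot_lmul_matrix inner_commute power2_norm_eq_inner vector_transpose_matrix)
  also have "\<dots> = v \<bullet> (orth_defect X *v v + v)"
    by (simp add: orth_defect_def matrix_vector_mult_diff_rdistrib matrix_vector_mul_assoc)
  also have "\<dots> = (norm v)\<^sup>2 + v \<bullet> (orth_defect X *v v)"
    by (simp add: inner_add_right power2_norm_eq_inner)
  finally have eq: "(norm (X *v v))\<^sup>2 = (norm v)\<^sup>2 + v \<bullet> (orth_defect X *v v)" .
  have "\<bar>v \<bullet> (orth_defect X *v v)\<bar> \<le> norm v * norm (orth_defect X *v v)"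
    by (rule Cauchy_Schwarz_ineq2)
  also have "\<dots> \<le> norm v * (R * norm v)"
    by (intro mult_left_mono order_trans[OF norm_matrix_vector_le_norm] mult_right_mono assms) auto
  finally have "(1 - R) * (norm v)\<^sup>2 \<le> (norm (X *v v))\<^sup>2"
    using eq by (simp add: power2_eq_square algebra_simps)
  then have "(sqrt (1 - R) * norm v)\<^sup>2 \<le> (norm (X *v v))\<^sup>2"
    using assms by (simp add: power_mult_distrib)
  then show ?thesis
    by (rule power2_le_imp_le) simp
qed

text \<open>The witness has orthogonal columns, all of length 1 except for one of length
  \<open>sqrt (1 + R)\<close>.\<close>

lemma exists_feasible_large_onorm:
  assumes "CARD('p) \<le> CARD('n)" "R \<ge> 0"
  obtains X :: "real^'p^'n" where "X \<in> feasible_tube R" "sqrt (1 + R) \<le> onorm ((*v) X)"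
proof -
  obtain g :: "'p \<Rightarrow> 'n" where g: "inj g"
    using card_le_inj[of "UNIV :: 'p set" "UNIV :: 'n set"] assms(1) by auto
  \<comment> \<open>Any column index will do; this merely fixes one.\<close>
  define a :: 'p where "a = undefined"
  define c where "c j = (if j = a then sqrt (1 + R) else 1)" for j
  define X :: "real^'p^'n" where "X = (\<chi> i j. if i = g j then c j else 0)"
  have XX: "(transpose X ** X) $ i $ j = (if i = j then (c j)\<^sup>2 else 0)" for i j
  proof -
    have "(transpose X ** X) $ i $ j =
        (\<Sum>k\<in>UNIV. (if k = g i then c i else 0) * (if k = g j then c j else 0))"
      by (simp add: X_def matrix_matrix_mult_def transpose_def)
    also have "\<dots> = (\<Sum>k\<in>UNIV. if k = g j then (if i = j then (c j)\<^sup>2 else 0) else 0)"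
      using g by (intro sum.cong) (auto simp: inj_def power2_eq_square)
    finally show ?thesis by simp
  qed
  have "(orth_defect X) = axis a (axis a R)"
    using assms(2) by (simp add: orth_defect_def vec_eq_iff XX mat_def axis_def c_def)
  then have "norm (orth_defect X) \<le> R"
    using assms(2) by (simp add: norm_eq_sqrt_inner inner_axis_axis)
  moreover have "sqrt (1 + R) \<le> onorm ((*v) X)"
  proof -
    have "X *v axis a 1 = axis (g a) (sqrt (1 + R))"
      unfolding matrix_vector_mult_basis
      by (simp add: X_def c_def axis_def column_def vec_eq_iff)
    then have "norm (X *v axis a 1) = sqrt (1 + R)"
      using assms(2) by (simp add: norm_eq_sqrt_inner inner_axis_axis)
    then show ?thesis
      using onorm[OF matrix_vector_mul_bounded_linear, of X "axis a 1"] by simp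
  qed
  ultimately show ?thesis using that by (simp add: feasible_tube_def)
qed

subsection \<open>Gradients of the augmented Lagrangian and of the merit function\<close>

text \<open>For symmetric \<open>B\<close> the two summands, being transposes of each other, pair
  equally with \<open>B\<close>. So \<open>2 X B\<close> is the gradient of the pairing of the
  defect with a fixed \<open>B\<close>.\<close>

lemma inner_sym_orth_defect_deriv:
  fixes X V :: "real^'p^'n"
  assumes "transpose B = B"
  shows "B \<bullet> (transpose X ** V + transpose V ** X) = 2 * (V \<bullet> (X ** B))"
proof -
  have 1: "B \<bullet> (transpose X ** V) = V \<bullet> (X ** B)"
    by (metis inner_commute inner_matrix_mult_left transpose_transpose)
  have "B \<bullet> (transpose V ** X) = transpose B \<bullet> transpose (transpose V ** X)"
    by (simp only: inner_transpose)
  also have "\<dots> = B \<bullet> (transpose X ** V)"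
    by (simp add: assms matrix_transpose_mul)
  finally show ?thesis using 1 by (simp add: inner_add_right)
qed

lemma inner_transpose_mult_sym:
  fixes X V :: "real^'p^'n"
  assumes "transpose B = B"
  shows "(transpose V ** X) \<bullet> B = V \<bullet> (X ** B)"
  by (metis assms inner_commute inner_matrix_mult_left inner_matrix_mult_right transpose_transpose)

lemma orth_defect_step:
  "orth_defect (X - t *\<^sub>R V) =
     orth_defect X - t *\<^sub>R (transpose X ** V + transpose V ** X) + t\<^sup>2 *\<^sub>R (transpose V ** V)"
  by (simp add: orth_defect_def bounded_bilinear.diff_left[OF bounded_bilinear_matrix_mult]
      bounded_bilinear.diff_right[OF bounded_bilinear_matrix_mult]
      bounded_bilinear.scaleR_left[OF bounded_bilinear_matrix_mult]
      bounded_bilinear.scaleR_right[OF bounded_bilinear_matrix_mult]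
      linear_diff[OF bounded_linear.linear[OF bounded_linear_transpose]]
      linear_scale[OF bounded_linear.linear[OF bounded_linear_transpose]]
      algebra_simps power2_eq_square)

lemma has_derivative_penalty:
  fixes X :: "real^'p^'n"
  shows "((\<lambda>Y. (norm (orth_defect Y))\<^sup>2) has_derivative (\<lambda>V. 4 * (V \<bullet> (X ** orth_defect X)))) (at X)"
proof -
  have "((\<lambda>Y. orth_defect Y \<bullet> orth_defect Y) has_derivative
      (\<lambda>V. orth_defect X \<bullet> (transpose X ** V + transpose V ** X)
         + (transpose X ** V + transpose V ** X) \<bullet> orth_defect X)) (at X)"
    by (rule has_derivative_inner has_derivative_orth_defect)+
  moreover have "orth_defect X \<bullet> (transpose X ** V + transpose V ** X)
         + (transpose X ** V + transpose V ** X) \<bullet> orth_defect X = 4 * (V \<bullet> (X ** orth_defect X))" for V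
    using inner_sym_orth_defect_deriv[OF transpose_orth_defect, of X X V]
    by (simp add: inner_commute[of _ "orth_defect X"])
  ultimately show ?thesis
    by (simp add: power2_norm_eq_inner)
qed

lemma grad_aug_lagrangian_eq:
  fixes f :: "real^'p^'n \<Rightarrow> real"
  assumes "f differentiable (at X)" "transpose \<Lambda> = \<Lambda>"
  shows "grad_aug_lagrangian f \<beta> X \<Lambda> = grad f X - X ** \<Lambda> + \<beta> *\<^sub>R (X ** orth_defect X)"
  unfolding grad_aug_lagrangian_def
proof (rule GDERIV_grad)
  have f: "(f has_derivative (\<lambda>V. V \<bullet> grad f X)) (at X)"
    using differentiable_GDERIV_grad[OF assms(1)] by (simp add: gderiv_def)
  have "((\<lambda>Y. \<Lambda> \<bullet> orth_defect Y) has_derivative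
       (\<lambda>V. \<Lambda> \<bullet> (transpose X ** V + transpose V ** X))) (at X)"
    by (rule bounded_linear.has_derivative[OF bounded_linear_inner_right has_derivative_orth_defect])
  then have \<Lambda>: "((\<lambda>Y. \<Lambda> \<bullet> orth_defect Y) has_derivative (\<lambda>V. 2 * (V \<bullet> (X ** \<Lambda>)))) (at X)"
    by (simp only: inner_sym_orth_defect_deriv[OF assms(2)])
  show "GDERIV (\<lambda>Y. aug_lagrangian f \<beta> Y \<Lambda>) X :> grad f X - X ** \<Lambda> + \<beta> *\<^sub>R (X ** orth_defect X)"
    unfolding gderiv_def aug_lagrangian_def
    by (rule derivative_eq_intros f \<Lambda> has_derivative_penalty refl)+
       (simp add: fun_eq_iff inner_diff_right inner_add_right)
qed

lemma twice_continuously_differentiableD: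
  assumes "twice_continuously_differentiable f"
  shows "f differentiable (at x)" "(grad f has_derivative hess f x) (at x)"
    and "continuous_on S f" "continuous_on S (grad f)" "continuous_on S (\<lambda>x. onorm (hess f x))"
proof -
  show f: "f differentiable (at x)" for x
    using assms by (simp add: twice_continuously_differentiable_def differentiable_on_def)
  have g: "grad f differentiable (at x)" for x
    using assms by (simp add: twice_continuously_differentiable_def differentiable_on_def)
  show h: "(grad f has_derivative hess f x) (at x)" for x
    unfolding hess_def using g by (simp add: frechet_derivative_works[symmetric])
  show "continuous_on S f" "continuous_on S (grad f)"
    using f g by (meson continuous_at_imp_continuous_on differentiable_imp_continuous_within)+
  have "onorm (hess f x) = norm (Blinfun (hess f x))" for x
    using has_derivative_bounded_linear[OF h] by (simp add: norm_blinfun.rep_eq bounded_linear_Blinfun_apply)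
  moreover have "continuous_on S (\<lambda>x. norm (Blinfun (hess f x)))"
    using assms unfolding twice_continuously_differentiable_def
    by (intro continuous_on_norm) (auto intro: continuous_on_subset)
  ultimately show "continuous_on S (\<lambda>x. onorm (hess f x))" by simp
qed

text \<open>The first term is the derivative with the multiplier frozen; the correction comes from
  the variation of the multiplier and carries the defect as a factor.\<close>

lemma has_derivative_merit:
  fixes f :: "real^'p^'n \<Rightarrow> real"
  assumes f: "twice_continuously_differentiable f"
  shows "(merit f \<beta> has_derivative (\<lambda>V. V \<bullet> grad_aug_lagrangian f \<beta> X (multiplier f X)
     - 1/2 * (hess f X V \<bullet> (X ** orth_defect X) + grad f X \<bullet> (V ** orth_defect X)))) (at X)"
proof -
  note D = twice_continuously_differentiableD[OF f]
  have \<Lambda>: "transpose (multiplier f X) = multiplier f X"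
    by (simp add: multiplier_def transpose_sym_part)
  have eq: "merit f \<beta> = (\<lambda>Y. f Y - 1/2 * (grad f Y \<bullet> (Y ** orth_defect Y))
      + \<beta>/4 * (norm (orth_defect Y))\<^sup>2)"
    by (simp add: fun_eq_iff merit_def multiplier_def inner_sym_part transpose_orth_defect
        inner_transpose_mult_sym)
  have df: "(f has_derivative (\<lambda>V. V \<bullet> grad f X)) (at X)"
    using differentiable_GDERIV_grad[OF D(1)] by (simp add: gderiv_def)
  \<comment> \<open>The derivative of the defect is symmetric as well, so pairing with it restores
    the symmetrized multiplier.\<close>
  have "grad f X \<bullet> (X ** (transpose X ** V + transpose V ** X)) = 2 * (V \<bullet> (X ** multiplier f X))" for V
  proof -
    have sym: "transpose (transpose X ** V + transpose V ** X) = transpose X ** V + transpose V ** X"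
      by (simp add: linear_add[OF bounded_linear.linear[OF bounded_linear_transpose]] matrix_transpose_mul)
    have "grad f X \<bullet> (X ** (transpose X ** V + transpose V ** X)) =
        multiplier f X \<bullet> (transpose X ** V + transpose V ** X)"
      unfolding multiplier_def by (simp add: inner_sym_part inner_transpose_mult_sym sym)
    then show ?thesis
      by (simp add: inner_sym_orth_defect_deriv[OF \<Lambda>])
  qed
  then have 2: "((\<lambda>Y. grad f Y \<bullet> (Y ** orth_defect Y)) has_derivative
     (\<lambda>V. 2 * (V \<bullet> (X ** multiplier f X)) + grad f X \<bullet> (V ** orth_defect X) + hess f X V \<bullet> (X ** orth_defect X))) (at X)"
    by (intro has_derivative_eq_rhs[OF has_derivative_inner[OF D(2)
        bounded_bilinear.FDERIV[OF bounded_bilinear_matrix_mult has_derivative_ident has_derivative_orth_defect]]])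
       (simp add: fun_eq_iff inner_add_right)
  show ?thesis
    unfolding eq grad_aug_lagrangian_eq[OF D(1) \<Lambda>]
    by (rule derivative_eq_intros df 2 has_derivative_penalty refl)+
       (simp add: fun_eq_iff inner_diff_right inner_add_right algebra_simps)
qed

lemma GDERIV_merit:
  assumes "twice_continuously_differentiable f"
  shows "GDERIV (merit f \<beta>) X :> grad (merit f \<beta>) X"
  using has_derivative_merit[OF assms] differentiable_GDERIV_grad differentiable_def by blast

lemma inner_grad_merit:
  fixes f :: "real^'p^'n \<Rightarrow> real"
  assumes "twice_continuously_differentiable f"
  shows "V \<bullet> grad (merit f \<beta>) X = V \<bullet> grad_aug_lagrangian f \<beta> X (multiplier f X)
     - 1/2 * (hess f X V \<bullet> (X ** orth_defect X) + grad f X \<bullet> (V ** orth_defect X))"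
proof -
  note has_derivative_unique[OF GDERIV_merit[OF assms, unfolded gderiv_def] has_derivative_merit[OF assms]]
  from fun_cong[OF this, of V] show ?thesis by simp
qed

text \<open>The Lipschitz condition is asked only along the segment from \<open>x\<close> to
  \<open>x - v\<close>, because the tube, where it will be available, need not be convex.\<close>

lemma descent_lemma:
  fixes h :: "'a::euclidean_space \<Rightarrow> real"
  assumes d: "\<And>s. 0 \<le> s \<Longrightarrow> s \<le> 1 \<Longrightarrow> GDERIV h (x - s *\<^sub>R v) :> grad h (x - s *\<^sub>R v)"
    and lip: "\<And>s. 0 \<le> s \<Longrightarrow> s \<le> 1 \<Longrightarrow> norm (grad h (x - s *\<^sub>R v) - grad h x) \<le> K * norm (s *\<^sub>R v)"
  shows "h (x - v) \<le> h x - v \<bullet> grad h x + K / 2 * (norm v)\<^sup>2"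
proof -
  \<comment> \<open>The deviation of \<open>h\<close> along the segment from its quadratic upper
    model; the claim is that it does not grow from 0 to 1.\<close>
  define \<phi> where "\<phi> s = h (x - s *\<^sub>R v) + s * (v \<bullet> grad h x) - K / 2 * s\<^sup>2 * (norm v)\<^sup>2" for s
  have "\<phi> 0 \<ge> \<phi> 1"
  proof (rule DERIV_nonpos_imp_nonincreasing[where f = \<phi>])
    fix s :: real assume s: "0 \<le> s" "s \<le> 1"
    have "((\<lambda>s. h (x - s *\<^sub>R v)) has_derivative (\<lambda>t. (- t *\<^sub>R v) \<bullet> grad h (x - s *\<^sub>R v))) (at s)"
      using d[OF s] unfolding gderiv_def
      by (rule has_derivative_compose[rotated]) (auto intro!: derivative_eq_intros)
    then have "((\<lambda>s. h (x - s *\<^sub>R v)) has_real_derivative (- (v \<bullet> grad h (x - s *\<^sub>R v)))) (at s)"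
      by (rule has_derivative_imp_has_field_derivative) simp
    then have D: "(\<phi> has_real_derivative (- (v \<bullet> grad h (x - s *\<^sub>R v)) + v \<bullet> grad h x - K * s * (norm v)\<^sup>2)) (at s)"
      unfolding \<phi>_def by (auto intro!: derivative_eq_intros)
    have "v \<bullet> (grad h x - grad h (x - s *\<^sub>R v)) \<le> norm v * norm (grad h x - grad h (x - s *\<^sub>R v))"
      by (rule norm_cauchy_schwarz)
    also have "\<dots> \<le> norm v * (K * norm (s *\<^sub>R v))"
      using lip[OF s] by (intro mult_left_mono) (auto simp: norm_minus_commute)
    finally have "- (v \<bullet> grad h (x - s *\<^sub>R v)) + v \<bullet> grad h x - K * s * (norm v)\<^sup>2 \<le> 0"
      using s by (simp add: inner_diff_right power2_eq_square mult_ac)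
    with D show "\<exists>y. (\<phi> has_real_derivative y) (at s) \<and> y \<le> 0" by blast
  qed simp
  then show ?thesis by (simp add: \<phi>_def)
qed

subsection \<open>Estimates on the tube\<close>

text \<open>\<open>M\<close>, \<open>N\<close> and \<open>L\<close> enter only as upper bounds over
  the tube, so the estimates do not have to deal with suprema.\<close>

locale penalized_tube =
  fixes f :: "real^'p^'n \<Rightarrow> real" and \<beta> R \<sigma> M N L :: real
  assumes C2: "twice_continuously_differentiable f"
    and R_pos: "0 < R" and \<sigma>_pos: "0 < \<sigma>" and \<sigma>_le_one: "\<sigma> \<le> 1" and R_le: "R \<le> 1 - \<sigma>\<^sup>2"
    and M_ge_one: "1 \<le> M" and N_nonneg: "0 \<le> N" and L_nonneg: "0 \<le> L"
    and \<beta>_pos: "0 < \<beta>" and \<beta>_gt: "4 * (M * N) \<le> \<beta> * \<sigma>\<^sup>2"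
    and M_bound: "(X :: real^'p^'n) \<in> feasible_tube R \<Longrightarrow> norm (X *v v) \<le> M * norm v"
    and N_bound: "X \<in> feasible_tube R \<Longrightarrow> norm (grad f X) \<le> N"
    and L_bound: "X \<in> feasible_tube R \<Longrightarrow> norm (hess f X V) \<le> L * norm V"
begin

text \<open>The constant called \<open>N\<^sub>L\<close> in the theorem; it bounds the search
  direction on the tube.\<close>

definition dir_bound where "dir_bound = (1 + M\<^sup>2) * N + \<beta> * R * M"

abbreviation dir :: "real^'p^'n \<Rightarrow> real^'p^'n" where
  "dir X \<equiv> grad_aug_lagrangian f \<beta> X (multiplier f X)"

abbreviation defect_deriv :: "real^'p^'n \<Rightarrow> real^'p^'p" where
  "defect_deriv X \<equiv> transpose X ** dir X + transpose (dir X) ** X"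

lemma R_le_one: "R \<le> 1"
  using R_le zero_le_power2[of \<sigma>] by linarith

lemma norm_feasible_mult_le:
  fixes X :: "real^'p^'n"
  assumes "X \<in> feasible_tube R"
  shows "norm (X ** B) \<le> M * norm B" "norm (transpose X ** C) \<le> M * norm C"
  using M_bound[OF assms] M_ge_one
  by (auto intro!: norm_matrix_mult_le norm_transpose_matrix_mult_le)

text \<open>The sharp constant \<open>sqrt (1 - R)\<close> is kept beside the smaller
  \<open>\<sigma>\<close>: the comparison of the defect with the search direction that yields the
  factor \<open>M / \<delta>\<close> is carried out with it.\<close>

lemma norm_feasible_mult_ge:
  fixes X :: "real^'p^'n"
  assumes "X \<in> feasible_tube R"
  shows "norm (X ** B) \<ge> sqrt (1 - R) * norm B"
  using assms R_le_one
  by (intro norm_matrix_mult_ge norm_matrix_vector_ge_of_orth_defect) (auto simp: feasible_tube_def)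

lemma \<sigma>_norm_le:
  fixes X :: "real^'p^'n"
  assumes "X \<in> feasible_tube R"
  shows "\<sigma> * norm B \<le> norm (X ** B)"
proof -
  have "\<sigma> \<le> sqrt (1 - R)"
    using R_le \<sigma>_pos by (intro real_le_rsqrt) auto
  then have "\<sigma> * norm B \<le> sqrt (1 - R) * norm B"
    by (rule mult_right_mono) simp
  with norm_feasible_mult_ge[OF assms, of B] show ?thesis by linarith
qed

section \<open>Size of the multiplier and of the search direction\<close>

lemma norm_multiplier_le:
  assumes "X \<in> feasible_tube R"
  shows "norm (multiplier f X) \<le> M * N"
proof -
  have "norm (multiplier f X) \<le> norm (transpose (grad f X) ** X)"
    unfolding multiplier_def by (rule norm_sym_part_le)
  also have "\<dots> = norm (transpose X ** grad f X)"
    by (metis matrix_transpose_mul norm_transpose transpose_transpose)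
  also have "\<dots> \<le> M * norm (grad f X)"
    by (rule norm_feasible_mult_le[OF assms])
  also have "\<dots> \<le> M * N"
    using N_bound[OF assms] M_ge_one by (intro mult_left_mono) auto
  finally show ?thesis .
qed

lemma transpose_multiplier: "transpose (multiplier f X) = multiplier f X"
  by (simp add: multiplier_def transpose_sym_part)

lemma dir_eq: "dir X = grad f X - X ** multiplier f X + \<beta> *\<^sub>R (X ** orth_defect X)"
  by (rule grad_aug_lagrangian_eq[OF twice_continuously_differentiableD(1)[OF C2] transpose_multiplier])

lemma norm_dir_le:
  assumes X: "X \<in> feasible_tube R"
  shows "norm (dir X) \<le> dir_bound"
proof -
  have "norm (dir X) \<le> norm (grad f X) + norm (X ** multiplier f X) + norm (\<beta> *\<^sub>R (X ** orth_defect X))"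
    unfolding dir_eq
    using norm_triangle_ineq[of "grad f X - X ** multiplier f X" "\<beta> *\<^sub>R (X ** orth_defect X)"]
      norm_triangle_ineq4[of "grad f X" "X ** multiplier f X"] by linarith
  moreover have "norm (X ** multiplier f X) \<le> M * (M * N)"
    using norm_feasible_mult_le(1)[OF X] norm_multiplier_le[OF X] M_ge_one
    by (meson mult_left_mono order_trans zero_le_one)
  moreover have "norm (X ** orth_defect X) \<le> M * R"
    using norm_feasible_mult_le(1)[OF X, of "orth_defect X"] X M_ge_one
    by (smt (verit) feasible_tube_def mem_Collect_eq mult_left_mono)
  then have "norm (\<beta> *\<^sub>R (X ** orth_defect X)) \<le> \<beta> * (M * R)"
    using \<beta>_pos by simp
  ultimately show ?thesis
    using N_bound[OF X] by (simp add: dir_bound_def power2_eq_square algebra_simps)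
qed

lemma abs_inner_defect_multiplier_le:
  assumes "X \<in> feasible_tube R"
  shows "\<bar>orth_defect X \<bullet> (orth_defect X ** multiplier f X)\<bar> \<le> M * N * (norm (orth_defect X))\<^sup>2"
proof -
  let ?E = "orth_defect X"
  have "\<bar>?E \<bullet> (?E ** multiplier f X)\<bar> \<le> norm ?E * norm (?E ** multiplier f X)"
    by (rule Cauchy_Schwarz_ineq2)
  also have "\<dots> \<le> norm ?E * (norm ?E * norm (multiplier f X))"
    by (intro mult_left_mono norm_matrix_mult) auto
  also have "\<dots> \<le> norm ?E * (norm ?E * (M * N))"
    by (intro mult_left_mono norm_multiplier_le assms) auto
  finally show ?thesis by (simp add: power2_eq_square mult_ac)
qed

text \<open>This is what the choice of the multiplier achieves: both pairings contain
  \<open>orth_defect X \<bullet> multiplier f X\<close>, which cancels, and only a term quadratic in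
  the defect survives.\<close>

lemma inner_defect_grad_minus:
  "(X ** orth_defect X) \<bullet> (grad f X - X ** multiplier f X) =
     - (orth_defect X \<bullet> (orth_defect X ** multiplier f X))"
proof -
  let ?E = "orth_defect X" and ?\<Lambda> = "multiplier f X"
  have "(X ** ?E) \<bullet> grad f X = ?E \<bullet> ?\<Lambda>"
    by (metis (no_types, lifting) inner_commute inner_sym_part inner_transpose_mult_sym
        multiplier_def transpose_orth_defect)
  moreover have "(X ** ?E) \<bullet> (X ** ?\<Lambda>) = ?E \<bullet> ((?E + mat 1) ** ?\<Lambda>)"
    by (simp add: inner_matrix_mult_left orth_defect_def matrix_mul_assoc)
  ultimately show ?thesis
    by (simp add: inner_diff_right bounded_bilinear.add_left[OF bounded_bilinear_matrix_mult] inner_add_right)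
qed

lemma inner_dir_defect:
  "dir X \<bullet> (X ** orth_defect X) = \<beta> * (norm (X ** orth_defect X))\<^sup>2
     - orth_defect X \<bullet> (orth_defect X ** multiplier f X)"
proof -
  have "dir X \<bullet> (X ** orth_defect X) = (grad f X - X ** multiplier f X) \<bullet> (X ** orth_defect X)
      + \<beta> * (norm (X ** orth_defect X))\<^sup>2"
    by (simp only: dir_eq inner_add_left inner_scaleR_left power2_norm_eq_inner)
  also have "(grad f X - X ** multiplier f X) \<bullet> (X ** orth_defect X)
      = - (orth_defect X \<bullet> (orth_defect X ** multiplier f X))"
    using inner_defect_grad_minus[of X] by (simp only: inner_commute)
  finally show ?thesis by simp
qed

text \<open>After expanding the square, the cross term is quadratic in the defect by the
  cancellation above. The resulting coefficient is the one that the square-root condition on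
  \<open>\<beta>\<close> controls.\<close>

lemma norm_dir_square_ge:
  assumes X: "X \<in> feasible_tube R"
  shows "(\<beta>\<^sup>2 * \<sigma>\<^sup>2 - 2 * \<beta> * (M * N)) * (norm (orth_defect X))\<^sup>2 \<le> (norm (dir X))\<^sup>2"
proof -
  let ?XE = "X ** orth_defect X" and ?G = "grad f X - X ** multiplier f X"
  have "(norm (dir X))\<^sup>2 = (norm ?G)\<^sup>2 + 2 * \<beta> * (?XE \<bullet> ?G) + \<beta>\<^sup>2 * (norm ?XE)\<^sup>2"
  proof -
    have "(norm (G + \<beta> *\<^sub>R B))\<^sup>2 = (norm G)\<^sup>2 + 2 * \<beta> * (B \<bullet> G) + \<beta>\<^sup>2 * (norm B)\<^sup>2"
      for G B :: "real^'p^'n"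
      unfolding power2_norm_eq_inner
      by (simp add: inner_add_left inner_add_right inner_commute power2_eq_square)
    then show ?thesis by (simp only: dir_eq)
  qed
  moreover have "2 * \<beta> * (?XE \<bullet> ?G) \<ge> 2 * \<beta> * (- (M * N * (norm (orth_defect X))\<^sup>2))"
    using abs_inner_defect_multiplier_le[OF X] \<beta>_pos
    by (intro mult_left_mono) (auto simp: inner_defect_grad_minus)
  moreover have "\<beta>\<^sup>2 * (norm ?XE)\<^sup>2 \<ge> \<beta>\<^sup>2 * (\<sigma> * norm (orth_defect X))\<^sup>2"
    using \<sigma>_norm_le[OF X] \<sigma>_pos by (intro mult_left_mono power_mono) auto
  moreover have "(\<beta>\<^sup>2 * \<sigma>\<^sup>2 - 2 * \<beta> * (M * N)) * (norm (orth_defect X))\<^sup>2 =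
      \<beta>\<^sup>2 * (\<sigma> * norm (orth_defect X))\<^sup>2 + 2 * \<beta> * (- (M * N * (norm (orth_defect X))\<^sup>2))"
    by (simp add: power_mult_distrib algebra_simps)
  moreover have "0 \<le> (norm ?G)\<^sup>2" by simp
  ultimately show ?thesis by linarith
qed

text \<open>The direction is tested against \<open>X ** orth_defect X\<close>, a multiple of the
  penalty gradient, and the norm of the test matrix is divided out.\<close>

lemma norm_dir_ge:
  assumes X: "X \<in> feasible_tube R"
  shows "(\<beta> * sqrt (1 - R) - M * N / sqrt (1 - R)) * norm (orth_defect X) \<le> norm (dir X)"
proof (cases "orth_defect X = 0")
  case False
  let ?s = "sqrt (1 - R)" and ?e = "norm (orth_defect X)" and ?x = "norm (X ** orth_defect X)"
  have s: "0 < ?s"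
    using R_le \<sigma>_pos by (smt (verit) real_sqrt_gt_zero zero_less_power)
  have e: "0 < ?e" using False by simp
  have x: "?s * ?e \<le> ?x" by (rule norm_feasible_mult_ge[OF X])
  then have x_pos: "0 < ?x" using s e by (smt (verit) mult_pos_pos)
  have "\<beta> * ?x\<^sup>2 - M * N * ?e\<^sup>2 \<le> dir X \<bullet> (X ** orth_defect X)"
    using abs_inner_defect_multiplier_le[OF X] by (simp add: inner_dir_defect)
  also have "\<dots> \<le> norm (dir X) * ?x" by (rule norm_cauchy_schwarz)
  finally have 1: "\<beta> * ?x\<^sup>2 - M * N * ?e\<^sup>2 \<le> norm (dir X) * ?x" .
  \<comment> \<open>One of the two factors \<open>?e\<close> is traded for \<open>?x / ?s\<close>,
    so that \<open>?x\<close> becomes a common factor.\<close>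
  have "M * N * ?e\<^sup>2 \<le> M * N * ?e * (?x / ?s)"
    using x s e M_ge_one N_nonneg
    by (simp add: power2_eq_square mult.assoc[symmetric] pos_le_divide_eq)
       (metis (no_types, opaque_lifting) mult.assoc mult.commute mult_left_mono mult_nonneg_nonneg
         norm_ge_zero order_trans zero_le_one)
  then have "(\<beta> * ?x - M * N / ?s * ?e) * ?x \<le> norm (dir X) * ?x"
    using 1 by (simp add: power2_eq_square algebra_simps)
  then have "\<beta> * ?x - M * N / ?s * ?e \<le> norm (dir X)"
    using x_pos by simp
  moreover have "\<beta> * (?s * ?e) \<le> \<beta> * ?x"
    using x \<beta>_pos by simp
  ultimately show ?thesis by (simp add: algebra_simps)
qed simp

section \<open>First-order change of the defect and of the merit function\<close>

lemma norm_defect_deriv_le_dir: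
  assumes X: "X \<in> feasible_tube R"
  shows "norm (defect_deriv X) \<le> 2 * M * norm (dir X)"
proof -
  have "norm (transpose (dir X) ** X) = norm (transpose X ** dir X)"
    by (metis matrix_transpose_mul norm_transpose transpose_transpose)
  then have "norm (defect_deriv X) \<le> 2 * norm (transpose X ** dir X)"
    using norm_triangle_ineq[of "transpose X ** dir X" "transpose (dir X) ** X"] by simp
  with norm_feasible_mult_le(2)[OF X, of "dir X"] show ?thesis by simp
qed

text \<open>The symmetric part of \<open>transpose X ** grad f X\<close> is the multiplier itself
  and cancels against the identity part of \<open>transpose X ** X\<close>. Every remaining term
  contains the defect, so the first-order change of the defect is bounded by a multiple of the
  defect.\<close>

lemma defect_deriv_eq:
  "defect_deriv X = 2 *\<^sub>R (\<beta> *\<^sub>R sym_part (transpose X ** (X ** orth_defect X))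
      - sym_part (orth_defect X ** multiplier f X))"
proof -
  let ?E = "orth_defect X" and ?\<Lambda> = "multiplier f X"
  note lin = bounded_linear.linear[OF sym_part_bounded_linear]
  have "transpose X ** (X ** ?\<Lambda>) = (?E + mat 1) ** ?\<Lambda>"
    by (simp add: orth_defect_def matrix_mul_assoc)
  then have "transpose X ** dir X = transpose X ** grad f X - (?E ** ?\<Lambda> + ?\<Lambda>)
      + \<beta> *\<^sub>R (transpose X ** (X ** ?E))"
    by (simp add: dir_eq bounded_bilinear.diff_right[OF bounded_bilinear_matrix_mult]
      bounded_bilinear.add_right[OF bounded_bilinear_matrix_mult]
      bounded_bilinear.scaleR_right[OF bounded_bilinear_matrix_mult]
      bounded_bilinear.add_left[OF bounded_bilinear_matrix_mult])
  moreover have "sym_part (transpose X ** grad f X) = ?\<Lambda>"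
    by (simp add: multiplier_def sym_part_def matrix_transpose_mul add.commute)
  moreover have "sym_part ?\<Lambda> = ?\<Lambda>"
    by (simp add: sym_part_def transpose_multiplier flip: scaleR_2)
  ultimately have "sym_part (transpose X ** dir X) = \<beta> *\<^sub>R sym_part (transpose X ** (X ** ?E))
      - sym_part (?E ** ?\<Lambda>)"
    by (simp add: linear_diff[OF lin] linear_add[OF lin] linear_scale[OF lin])
  moreover have "defect_deriv X = 2 *\<^sub>R sym_part (transpose X ** dir X)"
    by (simp add: sym_part_def matrix_transpose_mul)
  ultimately show ?thesis by simp
qed

lemma norm_defect_deriv_le_defect:
  assumes X: "X \<in> feasible_tube R"
  shows "norm (defect_deriv X) \<le> 2 * (M * N + \<beta> * M\<^sup>2) * norm (orth_defect X)"
proof -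
  let ?E = "orth_defect X" and ?\<Lambda> = "multiplier f X"
  have "norm (transpose X ** (X ** ?E)) \<le> M * (M * norm ?E)"
    using norm_feasible_mult_le[OF X] M_ge_one by (meson mult_left_mono order_trans zero_le_one)
  then have 1: "norm (sym_part (transpose X ** (X ** ?E))) \<le> M\<^sup>2 * norm ?E"
    using norm_sym_part_le[of "transpose X ** (X ** ?E)"] by (simp add: power2_eq_square)
  have "norm (?E ** ?\<Lambda>) \<le> norm ?E * (M * N)"
    using norm_matrix_mult[of ?E ?\<Lambda>] norm_multiplier_le[OF X]
    by (meson mult_left_mono norm_ge_zero order_trans)
  then have 2: "norm (sym_part (?E ** ?\<Lambda>)) \<le> M * N * norm ?E"
    using norm_sym_part_le[of "?E ** ?\<Lambda>"] by (simp add: mult_ac)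
  have "norm (\<beta> *\<^sub>R sym_part (transpose X ** (X ** ?E)) - sym_part (?E ** ?\<Lambda>))
      \<le> \<beta> * norm (sym_part (transpose X ** (X ** ?E))) + norm (sym_part (?E ** ?\<Lambda>))"
    using norm_triangle_ineq4[of "\<beta> *\<^sub>R sym_part (transpose X ** (X ** ?E))" "sym_part (?E ** ?\<Lambda>)"]
      \<beta>_pos by simp
  also have "\<dots> \<le> \<beta> * (M\<^sup>2 * norm ?E) + M * N * norm ?E"
    using 1 2 \<beta>_pos by (intro add_mono mult_left_mono) auto
  finally show ?thesis
    unfolding defect_deriv_eq norm_scaleR by (simp add: algebra_simps)
qed

lemma inner_defect_deriv_ge:
  assumes X: "X \<in> feasible_tube R"
  shows "2 * (\<beta> * \<sigma>\<^sup>2 - M * N) * (norm (orth_defect X))\<^sup>2 \<le> orth_defect X \<bullet> defect_deriv X"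
proof -
  have "orth_defect X \<bullet> defect_deriv X = 2 * (dir X \<bullet> (X ** orth_defect X))"
    by (rule inner_sym_orth_defect_deriv[OF transpose_orth_defect])
  moreover have "\<beta> * (norm (X ** orth_defect X))\<^sup>2 \<ge> \<beta> * (\<sigma> * norm (orth_defect X))\<^sup>2"
    using \<sigma>_norm_le[OF X] \<sigma>_pos \<beta>_pos by (intro mult_left_mono power_mono) auto
  ultimately show ?thesis
    using abs_inner_defect_multiplier_le[OF X]
    by (simp add: inner_dir_defect power_mult_distrib algebra_simps)
qed

text \<open>\<open>dir X\<close> differs from the gradient of the merit function only by the
  variation of the multiplier, whose two terms are estimated with \<open>L * M\<close> and with
  \<open>N\<close>.\<close>

lemma inner_dir_grad_merit_ge:
  assumes X: "X \<in> feasible_tube R"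
  shows "(norm (dir X))\<^sup>2 - 1/2 * (N + L * M) * norm (orth_defect X) * norm (dir X)
    \<le> dir X \<bullet> grad (merit f \<beta>) X"
proof -
  let ?e = "norm (orth_defect X)" and ?d = "norm (dir X)"
  have "hess f X (dir X) \<bullet> (X ** orth_defect X) \<le> norm (hess f X (dir X)) * norm (X ** orth_defect X)"
    by (rule norm_cauchy_schwarz)
  also have "\<dots> \<le> (L * ?d) * (M * ?e)"
    using L_nonneg by (intro mult_mono L_bound norm_feasible_mult_le X) auto
  finally have 1: "hess f X (dir X) \<bullet> (X ** orth_defect X) \<le> (L * ?d) * (M * ?e)" .
  have "grad f X \<bullet> (dir X ** orth_defect X) \<le> norm (grad f X) * norm (dir X ** orth_defect X)"
    by (rule norm_cauchy_schwarz)
  also have "\<dots> \<le> N * (?d * ?e)"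
    using N_nonneg by (intro mult_mono N_bound norm_matrix_mult X) auto
  finally show ?thesis
    using 1 by (simp add: inner_grad_merit[OF C2] power2_norm_eq_inner algebra_simps)
qed

text \<open>The step sizes \<open>t = 1/\<eta>\<close> for which the second and third terms in the maximum defining
  \<open>\<eta>_low\<close> are at most \<open>\<eta>\<close>; the first of those three terms controls only the merit function.\<close>

definition admissible :: "real \<Rightarrow> bool" where
  "admissible t \<longleftrightarrow> 0 \<le> t \<and> t * (dir_bound * (2 * M + sqrt (4 * M\<^sup>2 + 2 * R))) \<le> R \<and>
     t * (2 * (R + 2 * M\<^sup>2) * dir_bound\<^sup>2) \<le> R\<^sup>2 * (\<beta> * \<sigma>\<^sup>2 - 4 * (M * N))"

lemma dir_bound_ge: "\<beta> * R * M \<le> dir_bound" "0 \<le> dir_bound"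
  using N_nonneg \<beta>_pos R_pos M_ge_one by (auto simp: dir_bound_def)

lemma admissible_mono:
  assumes "admissible t" "0 \<le> s" "s \<le> t"
  shows "admissible s"
  using assms dir_bound_ge(2) M_ge_one R_pos mult_right_mono[OF \<open>s \<le> t\<close>] unfolding admissible_def
  by (smt (verit) mult_nonneg_nonneg real_sqrt_ge_zero zero_le_power2)

text \<open>With \<open>q = sqrt (4 M^2 + 2 R)\<close>, the positive root of
  \<open>\<tau>^2 + 2 M \<tau> = R/2\<close> is \<open>(q - 2 M)/2 = R/(q + 2 M)\<close>, so the
  first admissibility condition keeps \<open>\<tau>\<close> at or below this root. The bound 1/4
  follows from \<open>2 M + q \<ge> 4\<close>.\<close>

lemma admissible_step_bounds:
  assumes "admissible t"
  shows "(t * dir_bound)\<^sup>2 + 2 * M * (t * dir_bound) \<le> R / 2" "t * dir_bound \<le> 1/4"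
proof -
  define q where "q = sqrt (4 * M\<^sup>2 + 2 * R)"
  define \<tau> where "\<tau> = t * dir_bound"
  have q2: "q\<^sup>2 = 4 * M\<^sup>2 + 2 * R" using R_pos by (simp add: q_def)
  have q: "2 * M \<le> q"
    unfolding q_def using R_pos by (intro real_le_rsqrt) (auto simp: power_mult_distrib)
  have \<tau>: "0 \<le> \<tau>" "\<tau> * (2 * M + q) \<le> R"
    using assms dir_bound_ge(2) by (auto simp: admissible_def \<tau>_def q_def mult_ac)
  have "(2 * \<tau>) * (q + 2 * M) \<le> (q - 2 * M) * (q + 2 * M)"
    using \<tau> q2 by (simp add: algebra_simps power2_eq_square)
  then have "2 * \<tau> \<le> q - 2 * M"
    using q M_ge_one by (simp add: mult_le_cancel_right)
  then have "(2 * (\<tau> + M))\<^sup>2 \<le> q\<^sup>2"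
    using \<tau>(1) M_ge_one by (intro power_mono) auto
  then have "\<tau>\<^sup>2 + 2 * M * \<tau> \<le> R / 2"
    unfolding q2 by (simp add: power2_eq_square algebra_simps)
  then show "(t * dir_bound)\<^sup>2 + 2 * M * (t * dir_bound) \<le> R / 2" unfolding \<tau>_def .
  have "\<tau> * 4 \<le> \<tau> * (2 * M + q)"
    using \<tau>(1) q M_ge_one by (intro mult_left_mono) auto
  with \<tau>(2) R_le_one show "t * dir_bound \<le> 1/4" unfolding \<tau>_def by linarith
qed

section \<open>One admissible step: invariance of the tube and decrease of the potential\<close>

lemma orth_defect_dir_step:
  "orth_defect (X - t *\<^sub>R dir X) =
     orth_defect X - t *\<^sub>R (defect_deriv X - t *\<^sub>R (transpose (dir X) ** dir X))"
  by (simp add: orth_defect_step algebra_simps power2_eq_square)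

lemma norm_gram_dir_le: "norm (transpose (dir X) ** dir X) \<le> (norm (dir X))\<^sup>2"
  using norm_matrix_mult[of "transpose (dir X)" "dir X"]
  by (simp add: norm_transpose power2_eq_square)

lemma inner_defect_change_ge:
  assumes "X \<in> feasible_tube R" "0 \<le> t"
  shows "2 * (\<beta> * \<sigma>\<^sup>2 - M * N) * (norm (orth_defect X))\<^sup>2 - t * norm (orth_defect X) * (norm (dir X))\<^sup>2
     \<le> orth_defect X \<bullet> (defect_deriv X - t *\<^sub>R (transpose (dir X) ** dir X))"
proof -
  let ?Q = "transpose (dir X) ** dir X"
  have "orth_defect X \<bullet> ?Q \<le> norm (orth_defect X) * norm ?Q"
    by (rule norm_cauchy_schwarz)
  also have "\<dots> \<le> norm (orth_defect X) * (norm (dir X))\<^sup>2"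
    by (intro mult_left_mono norm_gram_dir_le) auto
  finally have "t * (orth_defect X \<bullet> ?Q) \<le> t * (norm (orth_defect X) * (norm (dir X))\<^sup>2)"
    using assms(2) by (rule mult_left_mono)
  with inner_defect_deriv_ge[OF assms(1)] show ?thesis
    by (simp add: inner_diff_right mult_ac)
qed

lemma norm_defect_change_le:
  assumes "0 \<le> t"
  shows "norm (defect_deriv X - t *\<^sub>R (transpose (dir X) ** dir X))
    \<le> norm (defect_deriv X) + t * (norm (dir X))\<^sup>2"
proof -
  have "norm (t *\<^sub>R (transpose (dir X) ** dir X)) \<le> t * (norm (dir X))\<^sup>2"
    using assms norm_gram_dir_le[of X] by (simp add: mult_left_mono)
  then show ?thesis
    using norm_triangle_ineq4[of "defect_deriv X" "t *\<^sub>R (transpose (dir X) ** dir X)"] by linarith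
qed

lemma norm_orth_defect_step_square:
  "(norm (orth_defect (X - t *\<^sub>R dir X)))\<^sup>2 = (norm (orth_defect X))\<^sup>2
    - t * (2 * (orth_defect X \<bullet> (defect_deriv X - t *\<^sub>R (transpose (dir X) ** dir X)))
      - t * (norm (defect_deriv X - t *\<^sub>R (transpose (dir X) ** dir X)))\<^sup>2)"
proof -
  have "(norm (E - t *\<^sub>R T))\<^sup>2 = (norm E)\<^sup>2 - t * (2 * (E \<bullet> T) - t * (norm T)\<^sup>2)"
    for E T :: "real^'p^'p"
    by (simp add: power2_norm_eq_inner inner_diff_left inner_diff_right inner_commute algebra_simps)
  then show ?thesis by (simp only: orth_defect_dir_step)
qed

text \<open>A step changes the defect by at most \<open>R/2\<close>, which settles the case of a
  small defect. For a large one the squared norm does not increase, since the first-order gain pays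
  for the second-order terms.\<close>

lemma feasible_tube_step:
  assumes X: "X \<in> feasible_tube R" and t: "admissible t"
  shows "X - t *\<^sub>R dir X \<in> feasible_tube R"
proof -
  define e d where "e = norm (orth_defect X)" and "d = norm (dir X)"
  define T where "T = defect_deriv X - t *\<^sub>R (transpose (dir X) ** dir X)"
  define \<tau> where "\<tau> = t * dir_bound"
  have t0: "0 \<le> t" using t by (simp add: admissible_def)
  have d: "0 \<le> d" "d \<le> dir_bound" using norm_dir_le[OF X] by (auto simp: d_def)
  have e: "0 \<le> e" "e \<le> R" using X by (auto simp: e_def feasible_tube_def)
  have \<tau>: "\<tau>\<^sup>2 + 2 * M * \<tau> \<le> R / 2" "0 \<le> \<tau>"
    using admissible_step_bounds[OF t] t0 dir_bound_ge by (auto simp: \<tau>_def)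
  have "norm T \<le> 2 * M * d + t * d\<^sup>2"
    using norm_defect_change_le[OF t0, of X] norm_defect_deriv_le_dir[OF X] by (simp add: T_def d_def)
  also have "\<dots> \<le> 2 * M * dir_bound + t * dir_bound\<^sup>2"
    using d t0 M_ge_one by (intro add_mono mult_left_mono power_mono) auto
  finally have T: "norm T \<le> dir_bound * (2 * M + \<tau>)"
    by (simp add: \<tau>_def power2_eq_square algebra_simps)
  show ?thesis
  proof (cases "e \<le> R / 2")
    case True
    have "t * norm T \<le> t * (dir_bound * (2 * M + \<tau>))"
      using T t0 by (rule mult_left_mono)
    also have "\<dots> \<le> R / 2"
      using \<tau>(1) by (simp add: \<tau>_def power2_eq_square algebra_simps)
    finally have "norm (orth_defect X - t *\<^sub>R T) \<le> R"
      using norm_triangle_ineq4[of "orth_defect X" "t *\<^sub>R T"] t0 True by (simp add: e_def)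
    then show ?thesis
      by (simp add: feasible_tube_def orth_defect_dir_step T_def)
  next
    case False
    define A c where "A = \<beta> * \<sigma>\<^sup>2 - M * N" and "c = t * dir_bound\<^sup>2"
    have c: "0 \<le> c" using t0 by (simp add: c_def)
    have MN: "0 \<le> M * N" using M_ge_one N_nonneg by simp
    have "2 * (R + 2 * M\<^sup>2) * c \<le> R\<^sup>2 * (\<beta> * \<sigma>\<^sup>2 - 4 * (M * N))"
      using t by (simp add: admissible_def c_def mult_ac)
    also have "\<dots> \<le> R\<^sup>2 * A"
      using MN by (intro mult_left_mono) (auto simp: A_def)
    finally have A: "2 * (R + 2 * M\<^sup>2) * c \<le> R\<^sup>2 * A" .
    have "t * (norm T)\<^sup>2 \<le> t * (dir_bound * (2 * M + \<tau>))\<^sup>2"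
      using T t0 by (intro mult_left_mono power_mono) auto
    also have "\<dots> = c * (2 * M + \<tau>)\<^sup>2"
      by (simp add: c_def power_mult_distrib)
    also have "\<dots> \<le> c * (4 * M\<^sup>2 + R)"
    proof (rule mult_left_mono[OF _ c])
      have "(2 * M + \<tau>)\<^sup>2 = 4 * M\<^sup>2 + 4 * (M * \<tau>) + \<tau>\<^sup>2"
        by (simp add: power2_eq_square algebra_simps)
      then show "(2 * M + \<tau>)\<^sup>2 \<le> 4 * M\<^sup>2 + R"
        using \<tau>(1) zero_le_power2[of \<tau>] by linarith
    qed
    finally have 1: "t * (norm T)\<^sup>2 \<le> c * (4 * M\<^sup>2 + R)" .
    have "(t * e) * d\<^sup>2 \<le> (t * e) * dir_bound\<^sup>2"
      using d t0 e by (intro mult_left_mono power_mono) auto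
    then have "t * e * d\<^sup>2 \<le> e * c" by (simp add: c_def mult_ac)
    moreover have "2 * A * e\<^sup>2 - t * e * d\<^sup>2 \<le> orth_defect X \<bullet> T"
      using inner_defect_change_ge[OF X t0] by (simp only: A_def T_def e_def d_def)
    ultimately have 2: "4 * A * e\<^sup>2 - 2 * e * c \<le> 2 * (orth_defect X \<bullet> T)"
      by linarith
    \<comment> \<open>The assumption \<open>e > R/2\<close> enters here: after division by
      \<open>c\<close> the inequality becomes an equality at \<open>e = R/2\<close>, and the
      difference of its sides is a sum of two terms with the factor \<open>2 e - R\<close>.\<close>
    have "R\<^sup>2 * (2 * e * c + c * (4 * M\<^sup>2 + R)) \<le> 4 * e\<^sup>2 * (2 * (R + 2 * M\<^sup>2) * c)"
    proof -
      have "0 \<le> R * ((4 * e + R) * (2 * e - R))" "0 \<le> 4 * M\<^sup>2 * ((2 * e - R) * (2 * e + R))"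
        using False e R_pos by auto
      then have "0 \<le> R * ((4 * e + R) * (2 * e - R)) + 4 * M\<^sup>2 * ((2 * e - R) * (2 * e + R))"
        by linarith
      also have "\<dots> = 8 * (R + 2 * M\<^sup>2) * e\<^sup>2 - R\<^sup>2 * (2 * e + 4 * M\<^sup>2 + R)"
        by (simp add: power2_eq_square algebra_simps)
      finally have "0 \<le> (8 * (R + 2 * M\<^sup>2) * e\<^sup>2 - R\<^sup>2 * (2 * e + 4 * M\<^sup>2 + R)) * c"
        using c by (rule mult_nonneg_nonneg)
      then show ?thesis by (simp add: algebra_simps)
    qed
    also have "\<dots> \<le> 4 * e\<^sup>2 * (R\<^sup>2 * A)"
      using A by (intro mult_left_mono) auto
    also have "\<dots> = R\<^sup>2 * (4 * A * e\<^sup>2)" by simp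
    finally have "2 * e * c + c * (4 * M\<^sup>2 + R) \<le> 4 * A * e\<^sup>2"
      using R_pos by (simp add: mult_le_cancel_left)
    then have "0 \<le> 2 * (orth_defect X \<bullet> T) - t * (norm T)\<^sup>2"
      using 1 2 by linarith
    then have "(norm (orth_defect (X - t *\<^sub>R dir X)))\<^sup>2 \<le> e\<^sup>2"
      unfolding norm_orth_defect_step_square e_def T_def[symmetric] using t0 by simp
    then have "norm (orth_defect (X - t *\<^sub>R dir X)) \<le> e"
      using e(1) by (rule power2_le_imp_le)
    then show ?thesis using e(2) by (simp add: feasible_tube_def)
  qed
qed

text \<open>\<open>w\<^sub>2\<close> is the lower bound for the squared direction supplied by the
  defect alone. When it makes up a large share of that square, the penalty falls by a definite
  amount, which is what the merit function lacks in this case.\<close>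

lemma penalty_decrease:
  assumes X: "X \<in> feasible_tube R" and t: "admissible t"
  defines "w\<^sub>2 \<equiv> (\<beta>\<^sup>2 * \<sigma>\<^sup>2 - 2 * \<beta> * (M * N)) * (norm (orth_defect X))\<^sup>2"
  shows "t * (2/3 * w\<^sub>2 - 9/64 * (norm (dir X))\<^sup>2)
    \<le> \<beta> / 4 * ((norm (orth_defect X))\<^sup>2 - (norm (orth_defect (X - t *\<^sub>R dir X)))\<^sup>2)"
proof -
  define e d s where "e = norm (orth_defect X)" and "d = norm (dir X)" and "s = norm (defect_deriv X)"
  define T where "T = defect_deriv X - t *\<^sub>R (transpose (dir X) ** dir X)"
  define B where "B = M * N + \<beta> * M\<^sup>2"
  have t0: "0 \<le> t" using t by (simp add: admissible_def)
  have MN: "0 \<le> M * N" using M_ge_one N_nonneg by simp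
  have d: "0 \<le> d" "t * d \<le> 1/4"
    using norm_dir_le[OF X] mult_left_mono[OF _ t0, of d dir_bound] admissible_step_bounds(2)[OF t]
    by (auto simp: d_def)
  have e: "0 \<le> e" "e \<le> 1" using X R_le_one by (auto simp: e_def feasible_tube_def)
  have B: "\<beta> \<le> B" 
    using MN M_ge_one \<beta>_pos by (auto simp: B_def intro: add_increasing)
  \<comment> \<open>The second admissibility condition is phrased with \<open>dir_bound\<close>, the
    first-order change of the defect is bounded with \<open>B\<close>;
    \<open>R * B \<le> M * dir_bound\<close> links the two.\<close>
  have "R * (M * N) \<le> 1 * (M * N)"
    using MN R_le_one by (rule mult_right_mono[rotated])
  moreover have "0 \<le> M * N * M\<^sup>2" using MN by simp
  moreover have "M * dir_bound = M * N + M * N * M\<^sup>2 + R * (\<beta> * M\<^sup>2)"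
    by (simp add: dir_bound_def algebra_simps power2_eq_square)
  moreover have "R * B = R * (M * N) + R * (\<beta> * M\<^sup>2)"
    by (simp add: B_def distrib_left)
  ultimately have "R * B \<le> M * dir_bound" by linarith
  then have "(R * B)\<^sup>2 \<le> (M * dir_bound)\<^sup>2"
    using R_pos B \<beta>_pos by (intro power_mono) auto
  then have "t * (4 * (R * B)\<^sup>2) \<le> t * (4 * (M * dir_bound)\<^sup>2)"
    using t0 by (intro mult_left_mono) auto
  also have "\<dots> \<le> t * (2 * (R + 2 * M\<^sup>2) * dir_bound\<^sup>2)"
    using t0 R_pos by (intro mult_left_mono) (auto simp: power_mult_distrib algebra_simps)
  also have "\<dots> \<le> R\<^sup>2 * (\<beta> * \<sigma>\<^sup>2 - 4 * (M * N))"
    using t by (simp add: admissible_def)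
  finally have "R\<^sup>2 * (t * (4 * B\<^sup>2)) \<le> R\<^sup>2 * (\<beta> * \<sigma>\<^sup>2 - 4 * (M * N))"
    by (simp add: power_mult_distrib mult_ac)
  then have tB: "t * (4 * B\<^sup>2) \<le> \<beta> * \<sigma>\<^sup>2 - 4 * (M * N)"
    using R_pos by (simp add: mult_le_cancel_left)
  have "t * \<beta> \<le> 1/4"
  proof -
    have "\<sigma>\<^sup>2 \<le> 1" using \<sigma>_pos \<sigma>_le_one by (simp add: power_le_one)
    then have "\<beta> * \<sigma>\<^sup>2 \<le> \<beta> * 1" using \<beta>_pos by (intro mult_left_mono) auto
    moreover have "t * (4 * \<beta>\<^sup>2) \<le> t * (4 * B\<^sup>2)"
      using B \<beta>_pos t0 by (intro mult_left_mono power_mono) auto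
    ultimately have "\<beta> * (4 * (t * \<beta>)) \<le> \<beta> * 1"
      using tB MN by (simp add: power2_eq_square mult_ac)
    then show ?thesis using \<beta>_pos by simp
  qed
  have s: "0 \<le> s" "s \<le> 2 * B * e"
    using norm_defect_deriv_le_defect[OF X] by (auto simp: s_def B_def e_def)
  have "t * s\<^sup>2 \<le> t * (2 * B * e)\<^sup>2"
    using s t0 by (intro mult_left_mono power_mono) auto
  also have "\<dots> = t * (4 * B\<^sup>2) * e\<^sup>2" by (simp add: power_mult_distrib)
  also have "\<dots> \<le> (\<beta> * \<sigma>\<^sup>2 - 4 * (M * N)) * e\<^sup>2"
    using tB by (intro mult_right_mono) auto
  finally have ts: "t * s\<^sup>2 \<le> (\<beta> * \<sigma>\<^sup>2 - 4 * (M * N)) * e\<^sup>2" .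
  have "(norm T)\<^sup>2 \<le> (s + t * d\<^sup>2)\<^sup>2"
    using norm_defect_change_le[OF t0, of X] by (intro power_mono) (auto simp: T_def s_def d_def)
  \<comment> \<open>Young's inequality in the form of a completed square; the weights 4/3 and 4 fix
    the later constants.\<close>
  also have "\<dots> = 4/3 * s\<^sup>2 + 4 * (t * d\<^sup>2)\<^sup>2 - (s - 3 * (t * d\<^sup>2))\<^sup>2 / 3"
    by (simp add: power2_eq_square field_simps)
  also have "\<dots> \<le> 4/3 * s\<^sup>2 + 4 * (t * d\<^sup>2)\<^sup>2"
    by simp
  finally have "t * (norm T)\<^sup>2 \<le> t * (4/3 * s\<^sup>2 + 4 * (t * d\<^sup>2)\<^sup>2)"
    using t0 by (rule mult_left_mono)
  moreover have "4 * (t * d\<^sup>2)\<^sup>2 \<le> d\<^sup>2 / 4"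
  proof -
    have "(t * d)\<^sup>2 \<le> (1/4)\<^sup>2" using d t0 by (intro power_mono) auto
    then have "(t * d)\<^sup>2 * d\<^sup>2 \<le> (1/4)\<^sup>2 * d\<^sup>2" by (rule mult_right_mono) simp
    then show ?thesis by (simp add: power2_eq_square mult_ac)
  qed
  then have "t * (4/3 * s\<^sup>2 + 4 * (t * d\<^sup>2)\<^sup>2) \<le> t * (4/3 * s\<^sup>2 + d\<^sup>2 / 4)"
    using t0 by (intro mult_left_mono) auto
  ultimately have T: "t * (norm T)\<^sup>2 \<le> 4/3 * ((\<beta> * \<sigma>\<^sup>2 - 4 * (M * N)) * e\<^sup>2) + t * d\<^sup>2 / 4"
    using ts by (simp add: algebra_simps)
  have "t * d\<^sup>2 * e \<le> t * d\<^sup>2"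
    using t0 e by (simp add: mult_left_le)
  moreover have "2 * (\<beta> * \<sigma>\<^sup>2 - M * N) * e\<^sup>2 - t * e * d\<^sup>2 \<le> orth_defect X \<bullet> T"
    using inner_defect_change_ge[OF X t0] by (simp only: T_def e_def d_def)
  ultimately have "4 * (\<beta> * \<sigma>\<^sup>2 - M * N) * e\<^sup>2 - 2 * (t * d\<^sup>2) \<le> 2 * (orth_defect X \<bullet> T)"
    by (simp add: algebra_simps)
  moreover have "8/3 * ((\<beta> * \<sigma>\<^sup>2 - 2 * (M * N)) * e\<^sup>2) \<le>
     4 * (\<beta> * \<sigma>\<^sup>2 - M * N) * e\<^sup>2 - 4/3 * ((\<beta> * \<sigma>\<^sup>2 - 4 * (M * N)) * e\<^sup>2)"
  proof -
    have "0 \<le> M * N * e\<^sup>2" using MN by simp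
    then show ?thesis by (simp add: algebra_simps)
  qed
  ultimately have main: "8/3 * ((\<beta> * \<sigma>\<^sup>2 - 2 * (M * N)) * e\<^sup>2) - 9/4 * (t * d\<^sup>2)
      \<le> 2 * (orth_defect X \<bullet> T) - t * (norm T)\<^sup>2"
    using T by linarith
  have "(t * \<beta>) * d\<^sup>2 \<le> 1/4 * d\<^sup>2"
    using \<open>t * \<beta> \<le> 1/4\<close> by (rule mult_right_mono) simp
  \<comment> \<open>Multiplication by \<open>\<beta>/4\<close> turns 8/3 into 2/3, and
    \<open>t * \<beta> \<le> 1/4\<close> turns \<open>9/16 * (t * \<beta>)\<close> into
    9/64.\<close>
  then have "2/3 * w\<^sub>2 - 9/64 * d\<^sup>2 \<le> \<beta> / 4 * (8/3 * ((\<beta> * \<sigma>\<^sup>2 - 2 * (M * N)) * e\<^sup>2) - 9/4 * (t * d\<^sup>2))"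
    by (simp add: w\<^sub>2_def e_def power2_eq_square algebra_simps)
  also have "\<dots> \<le> \<beta> / 4 * (2 * (orth_defect X \<bullet> T) - t * (norm T)\<^sup>2)"
    using main \<beta>_pos by (intro mult_left_mono) auto
  finally have "t * (2/3 * w\<^sub>2 - 9/64 * d\<^sup>2) \<le> t * (\<beta> / 4 * (2 * (orth_defect X \<bullet> T) - t * (norm T)\<^sup>2))"
    using t0 by (rule mult_left_mono)
  then show ?thesis
    unfolding norm_orth_defect_step_square T_def[symmetric] d_def by (simp add: mult_ac)
qed

text \<open>Each point of the segment is the result of a shorter step, which is again admissible; so
  the segment lies in the tube and the descent lemma applies.\<close>

lemma merit_decrease:
  assumes X: "X \<in> feasible_tube R" and t: "admissible t"
    and lip: "\<And>Y Z. Y \<in> feasible_tube R \<Longrightarrow> Z \<in> feasible_tube R \<Longrightarrow>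
      norm (grad (merit f \<beta>) Y - grad (merit f \<beta>) Z) \<le> H * norm (Y - Z)"
  shows "merit f \<beta> (X - t *\<^sub>R dir X)
    \<le> merit f \<beta> X - t * (dir X \<bullet> grad (merit f \<beta>) X) + H / 2 * t\<^sup>2 * (norm (dir X))\<^sup>2"
proof -
  have t0: "0 \<le> t" using t by (simp add: admissible_def)
  have step: "X - s *\<^sub>R t *\<^sub>R dir X \<in> feasible_tube R" if "0 \<le> s" "s \<le> 1" for s
    using feasible_tube_step[OF X admissible_mono[OF t, of "s * t"]] that t0
    by (simp add: mult_left_le_one_le)
  have "merit f \<beta> (X - t *\<^sub>R dir X) \<le> merit f \<beta> X - (t *\<^sub>R dir X) \<bullet> grad (merit f \<beta>) X
      + H / 2 * (norm (t *\<^sub>R dir X))\<^sup>2"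
  proof (rule descent_lemma)
    fix s :: real assume s: "0 \<le> s" "s \<le> 1"
    show "GDERIV (merit f \<beta>) (X - s *\<^sub>R t *\<^sub>R dir X) :> grad (merit f \<beta>) (X - s *\<^sub>R t *\<^sub>R dir X)"
      by (rule GDERIV_merit[OF C2])
    show "norm (grad (merit f \<beta>) (X - s *\<^sub>R t *\<^sub>R dir X) - grad (merit f \<beta>) X)
        \<le> H * norm (s *\<^sub>R t *\<^sub>R dir X)"
      using lip[OF step[OF s] X] by simp
  qed
  then show ?thesis by (simp add: power_mult_distrib mult.assoc)
qed

text \<open>\<open>t\<close> is the step taken and \<open>u\<close> stands for the smallest
  permitted step \<open>1/\<eta>_bar\<close>, at which \<open>c * u - H / 2 * u\<^sup>2\<close>
  equals \<open>c\<^sub>3\<close>. The spare term with \<open>t / 64\<close> yields the strict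
  inequality at the end.\<close>

lemma potential_decrease:
  assumes X: "X \<in> feasible_tube R" and t: "admissible t"
    and lip: "\<And>Y Z. Y \<in> feasible_tube R \<Longrightarrow> Z \<in> feasible_tube R \<Longrightarrow>
      norm (grad (merit f \<beta>) Y - grad (merit f \<beta>) Z) \<le> H * norm (Y - Z)"
    and c: "c < 1/2" "(N + L * M)\<^sup>2 / 4 \<le> (1 - 2 * c) * (\<beta>\<^sup>2 * \<sigma>\<^sup>2 - 2 * \<beta> * (M * N))"
    and H: "0 \<le> H" "H * t \<le> 2 * c" and u: "0 \<le> u" "u \<le> t"
  shows "4 * (c * u - H / 2 * u\<^sup>2) * (norm (dir X))\<^sup>2 + t / 64 * (norm (dir X))\<^sup>2
    \<le> 3 * (merit f \<beta> X - merit f \<beta> (X - t *\<^sub>R dir X))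
      + \<beta> / 4 * ((norm (orth_defect X))\<^sup>2 - (norm (orth_defect (X - t *\<^sub>R dir X)))\<^sup>2)"
proof -
  define e d where "e = norm (orth_defect X)" and "d = norm (dir X)"
  define w\<^sub>2 where "w\<^sub>2 = (\<beta>\<^sup>2 * \<sigma>\<^sup>2 - 2 * \<beta> * (M * N)) * e\<^sup>2"
  \<comment> \<open>Chosen so that the condition on \<open>\<beta>\<close> says exactly that the
    error coefficient \<open>1/2 * (N + L * M) * e\<close> is at most \<open>z\<close>.\<close>
  define z where "z = sqrt ((1 - 2 * c) * w\<^sub>2)"
  have t0: "0 \<le> t" using t by (simp add: admissible_def)
  have "0 \<le> (1 - 2 * c) * (\<beta>\<^sup>2 * \<sigma>\<^sup>2 - 2 * \<beta> * (M * N))"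
    using c(2) by (smt (verit) divide_nonneg_nonneg zero_le_power2)
  then have "0 \<le> \<beta>\<^sup>2 * \<sigma>\<^sup>2 - 2 * \<beta> * (M * N)"
    using c(1) by (simp add: zero_le_mult_iff)
  then have w2: "0 \<le> w\<^sub>2" "w\<^sub>2 \<le> d\<^sup>2"
    using norm_dir_square_ge[OF X] by (auto simp: w\<^sub>2_def e_def d_def)
  have z: "0 \<le> z" "z\<^sup>2 = (1 - 2 * c) * w\<^sub>2"
    using w2 c(1) by (auto simp: z_def)
  have "(1/2 * (N + L * M) * e)\<^sup>2 = (N + L * M)\<^sup>2 / 4 * e\<^sup>2"
    by (simp add: power_mult_distrib power_divide)
  also have "\<dots> \<le> (1 - 2 * c) * (\<beta>\<^sup>2 * \<sigma>\<^sup>2 - 2 * \<beta> * (M * N)) * e\<^sup>2"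
    using c(2) by (rule mult_right_mono) simp
  also have "\<dots> = z\<^sup>2" by (simp add: z w\<^sub>2_def)
  finally have "1/2 * (N + L * M) * e \<le> z"
    using z(1) by (rule power2_le_imp_le)
  then have "1/2 * (N + L * M) * e * d \<le> z * d"
    by (rule mult_right_mono) (simp add: d_def)
  then have "d\<^sup>2 - z * d \<le> dir X \<bullet> grad (merit f \<beta>) X"
    using inner_dir_grad_merit_ge[OF X] by (simp add: e_def d_def)
  then have "t * (d\<^sup>2 - z * d) \<le> t * (dir X \<bullet> grad (merit f \<beta>) X)"
    using t0 by (rule mult_left_mono)
  then have h: "t * (d\<^sup>2 - z * d) - H / 2 * t\<^sup>2 * d\<^sup>2 \<le> merit f \<beta> X - merit f \<beta> (X - t *\<^sub>R dir X)"
    using merit_decrease[OF X t lip] by (simp add: d_def)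
  \<comment> \<open>After \<open>4 c d\<^sup>2 = 2 d\<^sup>2 - 2 (1 - 2 c) d\<^sup>2\<close> the difference of the two sides is at least
    \<open>8/3 (z - 9/16 d)\<^sup>2\<close>.\<close>
  have "4 * c * d\<^sup>2 + d\<^sup>2 / 64 \<le> 3 * (d\<^sup>2 - z * d) + (2/3 * w\<^sub>2 - 9/64 * d\<^sup>2)"
  proof -
    have "(1 - 2 * c) * w\<^sub>2 \<le> (1 - 2 * c) * d\<^sup>2"
      using w2 c(1) by (intro mult_left_mono) auto
    then have "w\<^sub>2 - 2 * (c * w\<^sub>2) \<le> d\<^sup>2 - 2 * (c * d\<^sup>2)"
      by (simp add: algebra_simps)
    moreover have "0 \<le> c"
      using H mult_nonneg_nonneg[OF H(1) t0] by linarith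
    then have "0 \<le> c * w\<^sub>2"
      using w2 by simp
    moreover have "0 \<le> (z - 9/16 * d)\<^sup>2" by simp
    then have "0 \<le> 8/3 * z\<^sup>2 - 3 * (z * d) + 27/32 * d\<^sup>2"
      by (simp add: power2_eq_square algebra_simps)
    moreover have "z\<^sup>2 = w\<^sub>2 - 2 * (c * w\<^sub>2)"
      using z(2) by (simp add: algebra_simps)
    ultimately have "4 * (c * d\<^sup>2) + d\<^sup>2 / 64 \<le> 3 * d\<^sup>2 - 3 * (z * d) + 2/3 * w\<^sub>2 - 9/64 * d\<^sup>2"
      by linarith
    then show ?thesis by (simp add: right_diff_distrib mult.assoc)
  qed
  then have "t * (4 * c * d\<^sup>2 + d\<^sup>2 / 64) \<le> t * (3 * (d\<^sup>2 - z * d) + (2/3 * w\<^sub>2 - 9/64 * d\<^sup>2))"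
    using t0 by (rule mult_left_mono)
  \<comment> \<open>The difference of the two coefficients is
    \<open>2 (2 c - H t) (t - u) + H/2 (t - 2 u)^2\<close>. The square is available because the
    merit function has weight 3 and not 4.\<close>
  moreover have "4 * (c * u - H / 2 * u\<^sup>2) * d\<^sup>2 \<le> (4 * (c * t) - 3/2 * H * t\<^sup>2) * d\<^sup>2"
  proof (rule mult_right_mono)
    have "(H * t) * (t - u) \<le> 2 * c * (t - u)"
      using H u by (intro mult_right_mono) auto
    moreover have "0 \<le> H * (t - 2 * u)\<^sup>2" using H by simp
    ultimately show "4 * (c * u - H / 2 * u\<^sup>2) \<le> 4 * (c * t) - 3/2 * H * t\<^sup>2"
      by (simp add: power2_eq_square algebra_simps)
  qed simp
  ultimately show ?thesis
    using h penalty_decrease[OF X t] unfolding d_def[symmetric] e_def[symmetric] w\<^sub>2_def[symmetric]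
    by (simp add: algebra_simps)
qed

end

subsection \<open>The complexity bound\<close>

text \<open>The left side of the first assumption is the larger root, in \<open>\<beta>\<close>, of
  the quadratic equation obtained from the conclusion.\<close>

lemma parameter_quadratic_bound:
  fixes \<beta> \<sigma> m k q :: real
  assumes "m / \<sigma>\<^sup>2 + sqrt (m\<^sup>2 / \<sigma>^4 + q / (4 * \<sigma>\<^sup>2 * k)) < \<beta>" "0 < \<sigma>" "0 < k" "0 \<le> q"
  shows "q / 4 \<le> k * (\<beta>\<^sup>2 * \<sigma>\<^sup>2 - 2 * \<beta> * m)"
proof -
  define a where "a = m / \<sigma>\<^sup>2"
  have a: "m = a * \<sigma>\<^sup>2" "m\<^sup>2 / \<sigma>^4 = a\<^sup>2"
    using assms(2) by (auto simp: a_def power_divide)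
  have "sqrt (a\<^sup>2 + q / (4 * \<sigma>\<^sup>2 * k)) \<le> \<beta> - a"
    using assms(1) a(2) by (simp add: a_def)
  then have "a\<^sup>2 + q / (4 * \<sigma>\<^sup>2 * k) \<le> (\<beta> - a)\<^sup>2"
    by (rule sqrt_le_D)
  then have "q / (4 * \<sigma>\<^sup>2 * k) \<le> \<beta>\<^sup>2 - 2 * a * \<beta>"
    by (simp add: power2_eq_square algebra_simps)
  then have "q \<le> (\<beta>\<^sup>2 - 2 * a * \<beta>) * (4 * \<sigma>\<^sup>2 * k)"
    using assms by (simp add: pos_divide_le_eq)
  then show ?thesis by (simp add: a(1) algebra_simps)
qed

text \<open>The bound \<open>\<beta> s \<ge> m + \<delta>\<close> alone is too weak, as \<open>m\<close> occurs with the factor \<open>1/s\<close> in the claim.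
  The proof averages it, with weight \<open>1/M\<close>, with \<open>\<beta> s \<ge> 4 m / s\<close>; this suffices if \<open>4 - s \<le> 3 M\<close>.\<close>

lemma defect_coefficient_bound:
  fixes \<beta> \<sigma> s m M \<delta> :: real
  assumes "0 < \<sigma>" "\<sigma> \<le> s" "s \<le> 1" "1 \<le> M" "2 - s\<^sup>2 \<le> M\<^sup>2" "0 \<le> m" "0 < \<delta>"
    and "(m + \<delta>) / \<sigma> < \<beta>" "4 * m \<le> \<beta> * \<sigma>\<^sup>2"
  shows "\<delta> / M \<le> \<beta> * s - m / s"
proof -
  have \<beta>: "0 < \<beta>" using assms by (smt (verit) divide_pos_pos)
  have "m + \<delta> \<le> \<beta> * \<sigma>" using assms by (simp add: pos_divide_less_eq)
  also have "\<dots> \<le> \<beta> * s" using assms \<beta> by simp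
  finally have "(m + \<delta>) * s \<le> \<beta> * s * s"
    using assms by (intro mult_right_mono) auto
  moreover have "4 * m \<le> \<beta> * s\<^sup>2"
  proof -
    have "\<beta> * \<sigma>\<^sup>2 \<le> \<beta> * s\<^sup>2" using assms \<beta> by (intro mult_left_mono power_mono) auto
    with assms show ?thesis by linarith
  qed
  then have "(M - 1) * (4 * m) \<le> (M - 1) * (\<beta> * s\<^sup>2)"
    using assms by (intro mult_left_mono) auto
  moreover have "0 \<le> m * (3 * M - (4 - s))"
  proof -
    \<comment> \<open>This product is \<open>9 (2 - s^2) - (4 - s)^2\<close>.\<close>
    have "0 \<le> (1 - s) * (10 * s + 2)" using assms by (intro mult_nonneg_nonneg) auto
    then have "(4 - s)\<^sup>2 \<le> 9 * (2 - s\<^sup>2)" by (simp add: power2_eq_square algebra_simps)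
    also have "\<dots> \<le> (3 * M)\<^sup>2" using assms by (simp add: power_mult_distrib)
    finally have "4 - s \<le> 3 * M" by (rule power2_le_imp_le) (use assms in auto)
    with assms show ?thesis by simp
  qed
  ultimately have "\<delta> * s \<le> M * (\<beta> * s\<^sup>2 - m)"
    by (simp add: power2_eq_square algebra_simps)
  moreover have "\<beta> * s - m / s = (\<beta> * s\<^sup>2 - m) / s"
    using assms by (simp add: power2_eq_square field_simps)
  ultimately show ?thesis
    using assms by (simp add: pos_divide_le_eq pos_le_divide_eq mult_ac)
qed

theorem corollary4p8:
  fixes f :: "real^'p^'n \<Rightarrow> real"
    and X\<^sub>0 :: "real^'p^'n"
    and X :: "nat \<Rightarrow> real^'p^'n"
    and \<Lambda> :: "nat \<Rightarrow> real^'p^'p"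
    and \<C> :: "(real^'p^'n) set"
    and \<eta> :: "nat \<Rightarrow> real"
    and \<sigma> R f_low M N L L\<^sub>h N\<^sub>L \<beta> c\<^sub>1 c\<^sub>2 c\<^sub>3 \<eta>_low \<eta>_bar \<delta> :: real
    and K :: nat
  assumes "2 * CARD('p) \<le> CARD('n)"
    and "twice_continuously_differentiable f"
    and "qualified_guess \<sigma> X\<^sub>0"
    and "R = norm (orth_defect X\<^sub>0)"
    and "\<C> = feasible_tube R"
    and "f_low = (INF Y\<in>\<C>. f Y)"
    and "M = (SUP Y\<in>\<C>. onorm ((*v) Y))"
    and "N = (SUP Y\<in>\<C>. norm (grad f Y))"
    and "L = (SUP Y\<in>\<C>. onorm (hess f Y))"
    and "c\<^sub>1 \<in> {0<..<1/2}"
    and "\<beta> > Max {M * N / \<sigma>\<^sup>2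
                     + sqrt (M\<^sup>2 * N\<^sup>2 / \<sigma>^4 + (N + L * M)\<^sup>2 / (4 * \<sigma>\<^sup>2 * (1 - 2 * c\<^sub>1))),
                   M * N / \<sigma>,
                   4 * M * N / \<sigma>\<^sup>2}"
    and "L\<^sub>h > 0"
    and "\<forall>Y\<in>\<C>. \<forall>Z\<in>\<C>.
           norm (grad (merit f \<beta>) Y - grad (merit f \<beta>) Z) \<le> L\<^sub>h * norm (Y - Z)"
    and "N\<^sub>L = (1 + M\<^sup>2) * N + \<beta> * R * M"
    and "c\<^sub>2 \<in> {0<..R\<^sup>2 * (\<beta> * \<sigma>\<^sup>2 - 4 * M * N) / (2 * N\<^sub>L\<^sup>2)}"
    and "\<eta>_low = Max {L\<^sub>h / (2 * c\<^sub>1),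
                      (2 * N\<^sub>L * M + N\<^sub>L * sqrt (4 * M\<^sup>2 + 2 * R)) / R,
                      (R + 2 * M\<^sup>2) / c\<^sub>2}"
    and "\<eta>_bar \<ge> \<eta>_low"
    and "\<forall>k. \<eta> k \<in> {\<eta>_low..\<eta>_bar}"
    and "c\<^sub>3 = c\<^sub>1 / \<eta>_bar - L\<^sub>h / (2 * \<eta>_bar\<^sup>2)"
    and "c\<^sub>3 > 0"
    and "plam_sequence f \<beta> \<eta> X\<^sub>0 X \<Lambda>"
    and "\<delta> > 0"
    and "\<beta> > (M * N + \<delta>) / \<sigma>"
    and "K > 1"
  shows "(MIN k\<in>{..<K}. max (norm (mat 1 - transpose (X k) ** X k))
                             (norm (grad_aug_lagrangian f \<beta> (X k) (\<Lambda> k))))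
         < max (M / \<delta>) 1 * sqrt ((f X\<^sub>0 - f_low + M * N * R + \<beta> * R\<^sup>2 / 4) / (c\<^sub>3 * real K))"
proof -
  note tcd = assms(2) and qual = assms(3) and R_def = assms(4) and C_def = assms(5)
    and f_low_def = assms(6) and M_def = assms(7) and N_def = assms(8) and L_def = assms(9)
    and L\<^sub>h_pos = assms(12) and N\<^sub>L_def = assms(14) and c3_def = assms(19) and c3_pos = assms(20)
    and \<delta>_pos = assms(22) and \<beta>_\<delta> = assms(23)
  have \<sigma>: "0 < \<sigma>" "\<sigma> < 1" and R: "0 < R" "R \<le> 1 - \<sigma>\<^sup>2"
    using qual R_def by (auto simp: qualified_guess_def)
  have \<sigma>2: "0 < \<sigma>\<^sup>2" using \<sigma> by simp
  have R_less: "R < 1" using R \<sigma>2 by linarith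
  have c\<^sub>1: "0 < c\<^sub>1" "c\<^sub>1 < 1/2" using assms(10) by auto
  have X0: "X\<^sub>0 \<in> \<C>" by (simp add: C_def feasible_tube_def R_def)
  have cpt: "compact \<C>" unfolding C_def by (rule compact_feasible_tube)
  note cont = twice_continuously_differentiableD(3-5)[OF tcd]

  \<comment> \<open>Bounds for the suprema and the infimum over the tube\<close>
  have bdd: "bdd_above (g ` \<C>)" "bdd_below (g ` \<C>)" if "continuous_on \<C> g" for g :: "_ \<Rightarrow> real"
    using compact_imp_bounded[OF compact_continuous_image[OF that cpt]]
    by (auto intro: bounded_imp_bdd_above bounded_imp_bdd_below)
  have bdd_M: "bdd_above ((\<lambda>Y. onorm ((*v) Y)) ` \<C>)"
  proof -
    obtain b where "\<And>Y. Y \<in> \<C> \<Longrightarrow> norm Y \<le> b"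
      using compact_imp_bounded[OF cpt] unfolding bounded_iff by blast
    moreover have "onorm ((*v) Y) \<le> norm Y" for Y :: "real^'p^'n"
      by (rule onorm_bound) (simp_all add: norm_matrix_vector_le_norm)
    ultimately show ?thesis by (intro bdd_aboveI2[of _ _ b]) (blast intro: order_trans)
  qed
  have M: "onorm ((*v) Y) \<le> M" if "Y \<in> \<C>" for Y
    unfolding M_def by (rule cSUP_upper[OF that bdd_M])
  have N: "norm (grad f Y) \<le> N" if "Y \<in> \<C>" for Y
    unfolding N_def by (rule cSUP_upper[OF that bdd(1)]) (intro continuous_on_norm cont)
  have L: "onorm (hess f Y) \<le> L" if "Y \<in> \<C>" for Y
    unfolding L_def by (rule cSUP_upper[OF that bdd(1)]) (rule cont)
  have f_low: "f_low \<le> f Y" if "Y \<in> \<C>" for Y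
    unfolding f_low_def by (rule cINF_lower[OF bdd(2) that]) (rule cont)
  have hess: "bounded_linear (hess f Y)" for Y
    using twice_continuously_differentiableD(2)[OF tcd] by (rule has_derivative_bounded_linear)
  have N0: "0 \<le> N" using N[OF X0] norm_ge_zero order_trans by blast
  have L0: "0 \<le> L" using L[OF X0] onorm_pos_le[OF hess] order_trans by blast
  \<comment> \<open>Besides \<open>1 \<le> M\<close>, this gives
    \<open>1 + R \<le> M\<^sup>2\<close>, on which the factor \<open>M / \<delta>\<close>
    rests.\<close>
  have sqrt_M: "sqrt (1 + R) \<le> M"
  proof -
    have "CARD('p) \<le> CARD('n)" using assms(1) by linarith
    then obtain Y :: "real^'p^'n" where "Y \<in> feasible_tube R" "sqrt (1 + R) \<le> onorm ((*v) Y)"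
      using R by (auto intro: exists_feasible_large_onorm[of R])
    then show ?thesis using M[of Y] C_def by simp
  qed
  have M1: "1 \<le> M"
    using sqrt_M real_sqrt_ge_one[of "1 + R"] R by linarith
  have M2: "1 + R \<le> M\<^sup>2"
    using sqrt_M by (rule sqrt_le_D)
  have MN: "0 \<le> M * N" using M1 N0 by simp

  \<comment> \<open>Consequences of the conditions on \<open>\<beta>\<close>\<close>
  have \<beta>_max: "M * N / \<sigma>\<^sup>2 + sqrt (M\<^sup>2 * N\<^sup>2 / \<sigma>^4 + (N + L * M)\<^sup>2 / (4 * \<sigma>\<^sup>2 * (1 - 2 * c\<^sub>1))) < \<beta>"
    "4 * M * N / \<sigma>\<^sup>2 < \<beta>"
    using assms(11) by auto
  have "0 < (M * N + \<delta>) / \<sigma>" using MN \<delta>_pos \<sigma> by simp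
  then have \<beta>0: "0 < \<beta>" using \<beta>_\<delta> by linarith
  have \<beta>4: "4 * (M * N) < \<beta> * \<sigma>\<^sup>2"
    using \<beta>_max(2) \<sigma>2 by (simp add: pos_divide_less_eq mult_ac)
  have \<beta>_quad: "(N + L * M)\<^sup>2 / 4 \<le> (1 - 2 * c\<^sub>1) * (\<beta>\<^sup>2 * \<sigma>\<^sup>2 - 2 * \<beta> * (M * N))"
    by (rule parameter_quadratic_bound) (use \<beta>_max(1) \<sigma> c\<^sub>1 in \<open>auto simp: power_mult_distrib\<close>)

  interpret penalized_tube f \<beta> R \<sigma> M N L
  proof
    show "norm (Y *v v) \<le> M * norm v" if "Y \<in> feasible_tube R" for Y :: "real^'p^'n" and v
      using onorm[OF matrix_vector_mul_bounded_linear, of Y v]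
        mult_right_mono[OF M[of Y], of "norm v"] that by (simp add: C_def)
    show "norm (hess f Y V) \<le> L * norm V" if "Y \<in> feasible_tube R" for Y V
      using onorm[OF hess, of Y V] mult_right_mono[OF L[of Y], of "norm V"] that
      by (simp add: C_def)
  qed (use tcd R \<sigma> M1 N0 L0 \<beta>0 \<beta>4 N C_def in auto)
  have N\<^sub>L: "N\<^sub>L = dir_bound" by (simp add: N\<^sub>L_def dir_bound_def)
  have N\<^sub>L_pos: "0 < N\<^sub>L"
    unfolding N\<^sub>L using dir_bound_ge(1) \<beta>0 R M1 by (smt (verit) mult_pos_pos)

  \<comment> \<open>Admissible step sizes and feasible iterates\<close>
  have \<eta>_low: "L\<^sub>h / (2 * c\<^sub>1) \<le> \<eta>_low" "(2 * N\<^sub>L * M + N\<^sub>L * sqrt (4 * M\<^sup>2 + 2 * R)) / R \<le> \<eta>_low"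
    "(R + 2 * M\<^sup>2) / c\<^sub>2 \<le> \<eta>_low"
    unfolding assms(16) by (auto intro!: Max_ge)
  have \<eta>_low_pos: "0 < \<eta>_low"
    using \<eta>_low(1) L\<^sub>h_pos c\<^sub>1 by (smt (verit) divide_pos_pos)
  have \<eta>: "\<eta>_low \<le> \<eta> k" "\<eta> k \<le> \<eta>_bar" for k using assms(18) by auto
  have \<eta>_pos: "0 < \<eta> k" for k using \<eta>(1)[of k] \<eta>_low_pos by linarith
  have adm: "admissible (1 / \<eta> k)" for k
    unfolding admissible_def N\<^sub>L[symmetric]
  proof (intro conjI)
    show "0 \<le> 1 / \<eta> k" using \<eta>_pos[of k] by simp
    have "(2 * N\<^sub>L * M + N\<^sub>L * sqrt (4 * M\<^sup>2 + 2 * R)) / R \<le> \<eta> k"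
      using \<eta>_low(2) \<eta>(1) by (rule order_trans)
    then have "N\<^sub>L * (2 * M + sqrt (4 * M\<^sup>2 + 2 * R)) \<le> R * \<eta> k"
      using R by (simp add: pos_divide_le_eq algebra_simps)
    then show "1 / \<eta> k * (N\<^sub>L * (2 * M + sqrt (4 * M\<^sup>2 + 2 * R))) \<le> R"
      using \<eta>_pos[of k] by (simp add: pos_divide_le_eq)
    \<comment> \<open>The upper bound on \<open>c\<^sub>2\<close> converts the third term of
      \<open>\<eta>_low\<close> into the second admissibility condition.\<close>
    have c\<^sub>2: "0 < c\<^sub>2" "c\<^sub>2 * (2 * N\<^sub>L\<^sup>2) \<le> R\<^sup>2 * (\<beta> * \<sigma>\<^sup>2 - 4 * (M * N))"
      using assms(15) N\<^sub>L_pos by (auto simp: pos_le_divide_eq mult.assoc)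
    have "R + 2 * M\<^sup>2 \<le> \<eta> k * c\<^sub>2"
      using order_trans[OF \<eta>_low(3) \<eta>(1)[of k]] c\<^sub>2(1) by (simp add: pos_divide_le_eq)
    then have "(R + 2 * M\<^sup>2) * (2 * N\<^sub>L\<^sup>2) \<le> \<eta> k * c\<^sub>2 * (2 * N\<^sub>L\<^sup>2)"
      by (rule mult_right_mono) simp
    also have "\<dots> \<le> \<eta> k * (R\<^sup>2 * (\<beta> * \<sigma>\<^sup>2 - 4 * (M * N)))"
      unfolding mult.assoc[of "\<eta> k"] using c\<^sub>2(2) \<eta>_pos[of k] by (intro mult_left_mono) auto
    finally have "2 * (R + 2 * M\<^sup>2) * N\<^sub>L\<^sup>2 \<le> R\<^sup>2 * (\<beta> * \<sigma>\<^sup>2 - 4 * (M * N)) * \<eta> k"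
      by (simp only: mult_ac)
    then show "1 / \<eta> k * (2 * (R + 2 * M\<^sup>2) * N\<^sub>L\<^sup>2) \<le> R\<^sup>2 * (\<beta> * \<sigma>\<^sup>2 - 4 * (M * N))"
      using \<eta>_pos[of k] by (simp add: pos_divide_le_eq)
  qed

  have X_0: "X 0 = X\<^sub>0" and \<Lambda>: "\<Lambda> k = multiplier f (X k)"
    and X_Suc: "X (Suc k) = X k - (1 / \<eta> k) *\<^sub>R dir (X k)" for k
    using assms(21) by (auto simp: plam_sequence_def)
  have XC: "X k \<in> feasible_tube R" for k
  proof (induction k)
    case 0
    then show ?case using X0 by (simp add: X_0 C_def)
  next
    case (Suc k)
    then show ?case unfolding X_Suc by (rule feasible_tube_step[OF _ adm])
  qed

  \<comment> \<open>The potential and its total drop\<close>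
  define e d where "e k = norm (orth_defect (X k))" and "d k = norm (dir (X k))" for k
  define P where "P k = 3 * merit f \<beta> (X k) + \<beta> / 4 * (e k)\<^sup>2" for k
  define gap where "gap = f X\<^sub>0 - f_low + M * N * R + \<beta> * R\<^sup>2 / 4"
  have e: "0 \<le> e k" "e k \<le> R" for k
    using XC[of k] by (auto simp: e_def feasible_tube_def)
  have e0: "e 0 = R" by (simp add: e_def X_0 R_def)

  have decrease: "4 * c\<^sub>3 * (d k)\<^sup>2 + 1 / \<eta> k / 64 * (d k)\<^sup>2 \<le> P k - P (Suc k)" for k
  proof -
    have "4 * (c\<^sub>1 * (1 / \<eta>_bar) - L\<^sub>h / 2 * (1 / \<eta>_bar)\<^sup>2) * (norm (dir (X k)))\<^sup>2
        + 1 / \<eta> k / 64 * (norm (dir (X k)))\<^sup>2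
      \<le> 3 * (merit f \<beta> (X k) - merit f \<beta> (X k - (1 / \<eta> k) *\<^sub>R dir (X k)))
        + \<beta> / 4 * ((norm (orth_defect (X k)))\<^sup>2 - (norm (orth_defect (X k - (1 / \<eta> k) *\<^sub>R dir (X k))))\<^sup>2)"
    proof (rule potential_decrease[OF XC adm _ c\<^sub>1(2) \<beta>_quad])
      show "norm (grad (merit f \<beta>) Y - grad (merit f \<beta>) Z) \<le> L\<^sub>h * norm (Y - Z)"
        if "Y \<in> feasible_tube R" "Z \<in> feasible_tube R" for Y Z
        using assms(13) that C_def by blast
      show "L\<^sub>h * (1 / \<eta> k) \<le> 2 * c\<^sub>1"
        using order_trans[OF \<eta>_low(1) \<eta>(1)[of k]] \<eta>_pos[of k] c\<^sub>1
        by (simp add: pos_divide_le_eq mult_ac)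
      show "0 \<le> 1 / \<eta>_bar" "1 / \<eta>_bar \<le> 1 / \<eta> k"
        using \<eta>[of k] \<eta>_pos[of k] by (auto simp: frac_le)
    qed (use L\<^sub>h_pos in simp)
    then show ?thesis
      unfolding X_Suc[symmetric] d_def[symmetric] e_def[symmetric] P_def
      by (simp add: c3_def power_divide algebra_simps)
  qed

  have pairing: "\<bar>multiplier f (X k) \<bullet> orth_defect (X k)\<bar> \<le> M * N * R" for k
  proof -
    have "\<bar>multiplier f (X k) \<bullet> orth_defect (X k)\<bar> \<le> norm (multiplier f (X k)) * e k"
      unfolding e_def by (rule Cauchy_Schwarz_ineq2)
    also have "\<dots> \<le> M * N * R"
      using norm_multiplier_le[OF XC] e MN by (intro mult_mono) auto
    finally show ?thesis .
  qed
  \<comment> \<open>The penalty has total coefficient \<open>\<beta>\<close> in \<open>P\<close>,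
    exactly matched by \<open>4 * gap\<close>. The drop of \<open>f\<close> and the pairing bound
    \<open>M * N * R\<close> occur three times in the estimate and four times in
    \<open>4 * gap\<close>; both are nonnegative.\<close>
  have P_gap: "P 0 - P K \<le> 4 * gap"
  proof -
    have "f_low \<le> f (X K)" "f_low \<le> f X\<^sub>0"
      using f_low XC X0 C_def by auto
    moreover have "0 \<le> \<beta> * (e K)\<^sup>2" using \<beta>0 by simp
    moreover have "0 \<le> M * N * R" using MN R by simp
    moreover have "P 0 = 3 * f X\<^sub>0 - 3/2 * (multiplier f (X 0) \<bullet> orth_defect (X 0)) + \<beta> * R\<^sup>2"
      using e0 by (simp add: P_def merit_def e_def[symmetric] X_0[symmetric])
    moreover have "P K = 3 * f (X K) - 3/2 * (multiplier f (X K) \<bullet> orth_defect (X K)) + \<beta> * (e K)\<^sup>2"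
      by (simp add: P_def merit_def e_def[symmetric])
    moreover have "- (M * N * R) \<le> multiplier f (X 0) \<bullet> orth_defect (X 0)"
      "multiplier f (X K) \<bullet> orth_defect (X K) \<le> M * N * R"
      using pairing[of 0] pairing[of K] by (auto simp: abs_le_iff)
    moreover have "4 * gap = 4 * f X\<^sub>0 - 4 * f_low + 4 * (M * N * R) + \<beta> * R\<^sup>2"
      by (simp add: gap_def algebra_simps)
    ultimately show ?thesis by linarith
  qed

  have defect_le: "\<delta> / M * e k \<le> d k" for k
  proof -
    \<comment> \<open>Applied with \<open>s = sqrt (1 - R)\<close>, for which \<open>2 - s^2\<close>
      is \<open>1 + R\<close>.\<close>
    have "\<delta> / M \<le> \<beta> * sqrt (1 - R) - M * N / sqrt (1 - R)"
    proof (rule defect_coefficient_bound[OF \<sigma>(1)])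
      show "\<sigma> \<le> sqrt (1 - R)" using R by (intro real_le_rsqrt) auto
    qed (use R R_less M1 M2 MN \<delta>_pos \<beta>_\<delta> \<beta>4 in auto)
    then have "\<delta> / M * e k \<le> (\<beta> * sqrt (1 - R) - M * N / sqrt (1 - R)) * e k"
      using e by (intro mult_right_mono) auto
    then show ?thesis
      using norm_dir_ge[OF XC] unfolding e_def d_def by (rule order_trans)
  qed
  have "0 < d 0"
    using defect_le[of 0] e0 R \<delta>_pos M1 by (smt (verit) divide_pos_pos mult_pos_pos)

  \<comment> \<open>Strictness comes from index 0: there the defect has norm \<open>R > 0\<close>,
    so the direction is nonzero and the spare term is positive.\<close>
  have "(\<Sum>k<K. 4 * c\<^sub>3 * (d k)\<^sup>2) < (\<Sum>k<K. P k - P (Suc k))"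
  proof (rule sum_strict_mono_ex1)
    have "0 \<le> 1 / \<eta> k / 64 * (d k)\<^sup>2" for k using \<eta>_pos[of k] by simp
    then show "\<forall>k\<in>{..<K}. 4 * c\<^sub>3 * (d k)\<^sup>2 \<le> P k - P (Suc k)"
      using decrease by (smt (verit))
    have "0 < 1 / \<eta> 0 / 64 * (d 0)\<^sup>2" using \<eta>_pos[of 0] \<open>0 < d 0\<close> by simp
    then show "\<exists>k\<in>{..<K}. 4 * c\<^sub>3 * (d k)\<^sup>2 < P k - P (Suc k)"
      using decrease[of 0] assms(24) by (intro bexI[of _ 0]) auto
  qed simp
  also have "\<dots> = P 0 - P K" by (rule sum_lessThan_telescope')
  also have "\<dots> \<le> 4 * gap" by (rule P_gap)
  finally have sum_d: "c\<^sub>3 * (\<Sum>k<K. (d k)\<^sup>2) < gap"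
    by (simp add: sum_distrib_left[symmetric] mult.assoc)

  \<comment> \<open>From the sum of squares to the minimum\<close>
  define A where "A = max (M / \<delta>) 1"
  define \<mu> where "\<mu> = (MIN k\<in>{..<K}. max (e k) (d k))"
  have A: "1 \<le> A" by (simp add: A_def)
  have \<mu>_le: "\<mu> \<le> max (e k) (d k)" if "k < K" for k
    unfolding \<mu>_def using that by (intro Min_le) auto
  have \<mu>0: "0 \<le> \<mu>"
    unfolding \<mu>_def using assms(24) e(1) by (subst Min_ge_iff) (auto simp: le_max_iff_disj)
  \<comment> \<open>Both \<open>e k\<close> and \<open>d k\<close> are at most
    \<open>A * d k\<close>, so \<open>\<mu> / A\<close> bounds every \<open>d k\<close> from
    below.\<close>
  have "(\<mu> / A)\<^sup>2 \<le> (d k)\<^sup>2" if "k < K" for k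
  proof (rule power_mono)
    have d: "0 \<le> d k" by (simp add: d_def)
    have "e k \<le> M / \<delta> * d k"
      using defect_le[of k] M1 \<delta>_pos by (simp add: field_simps)
    also have "\<dots> \<le> A * d k"
      using d by (intro mult_right_mono) (simp_all add: A_def)
    finally have "e k \<le> A * d k" .
    moreover have "1 * d k \<le> A * d k" using A d by (rule mult_right_mono)
    ultimately have "\<mu> \<le> A * d k" using \<mu>_le[OF that] by simp
    then show "\<mu> / A \<le> d k" using A by (simp add: pos_divide_le_eq mult.commute)
    show "0 \<le> \<mu> / A" using A \<mu>0 by simp
  qed
  then have "(\<Sum>k<K. (\<mu> / A)\<^sup>2) \<le> (\<Sum>k<K. (d k)\<^sup>2)"
    by (intro sum_mono) auto
  then have "c\<^sub>3 * (real K * (\<mu> / A)\<^sup>2) \<le> c\<^sub>3 * (\<Sum>k<K. (d k)\<^sup>2)"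
    using c3_pos by simp
  with sum_d have "(\<mu> / A)\<^sup>2 * (c\<^sub>3 * real K) < gap" by (simp add: mult_ac)
  then have "(\<mu> / A)\<^sup>2 < gap / (c\<^sub>3 * real K)"
    using c3_pos assms(24) by (simp add: pos_less_divide_eq)
  then have "\<mu> / A < sqrt (gap / (c\<^sub>3 * real K))"
    by (rule real_less_rsqrt)
  then have "\<mu> < A * sqrt (gap / (c\<^sub>3 * real K))"
    using A by (simp add: pos_divide_less_eq mult.commute)
  moreover have "norm (mat 1 - transpose (X k) ** X k) = e k" for k
    by (simp add: e_def orth_defect_def norm_minus_commute)
  ultimately show ?thesis
    by (simp add: \<mu>_def A_def gap_def d_def \<Lambda>)
qed

end
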